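(* Assume that $2^{\omega_1}=\mathfrak c$. Then there exist pseudocomplete locally convex spaces $K$ and $L$ such that all closed vector subspaces of $K$ and all closed vector subspaces of $L$ are separable, but the product $K\times L$ contains a closed non-separable $\sigma$-compact vector subspace $M$.
   Context: All locally convex spaces are assumed to be Hausdorff, and the scalar field is $\mathbb R$. $\mathfrak c=2^{\omega}$ is the cardinality of the continuum and $\omega_1$ is the first uncountable cardinal. A space is separable if it contains a countable dense subset; vector subspaces carry the subspace topology. A space is $\sigma$-compact if it is a countable union of compact subspaces. A $\pi$-base for a space $X$ is a family $\mathcal P$ of non-empty open subsets of $X$ such that every non-empty open set in $X$ contains an element of $\mathcal P$. A topological space $X$ is pseudocomplete if there exists a sequence $\{\mathcal P_n: n\in\omega\}$ of $\pi$-bases for $X$ such that for every sequence $\{U_n:n\in\omega\}$ of subsets of $X$ satisfying $U_n\in\mathcal P_n$ and $\mathrm{cl}_X U_{n+1}\subset U_n$ for each $n\in\omega$, the intersection $\bigcap_{n\in\omega}U_n$ is non-empty. *)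

theory Defs
  imports "HOL-Analysis.Analysis" "HOL-Library.Function_Algebras"
begin

unbundle cardinal_syntax

text \<open>
  Pointwise vector operations on functions. An existential statement cannot range over types, so
  existence of a space is to be asserted for spaces whose underlying vector space is a
  linear subspace of \<open>real \<Rightarrow> real\<close> (with an arbitrary topology). This loses no generality for separable Hausdorff spaces: such a space has
  at most $2^{\mathfrak c}$ points, and \<open>real \<Rightarrow> real\<close> has linear dimension $2^{\mathfrak c}$.
\<close>

instantiation "fun" :: (type, real_vector) real_vector
begin

definition scaleR_fun_def: "c *\<^sub>R f = (\<lambda>x. c *\<^sub>R f x)"

instance
  by standard (simp_all add: scaleR_fun_def fun_eq_iff scaleR_add_right scaleR_add_left)

end

text \<open>
  A locally convex space is a linear subspace \<open>topspace T\<close> of an ambient real vector space,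
  with a vector topology \<open>T\<close> of its own, which need not be induced by
  a topology of the ambient space.
\<close>

definition locally_convex_space :: "'a::real_vector topology \<Rightarrow> bool" where
  "locally_convex_space T \<longleftrightarrow>
     subspace (topspace T) \<and>
     continuous_map (prod_topology T T) T (\<lambda>(x, y). x + y) \<and>
     continuous_map (prod_topology euclideanreal T) T (\<lambda>(c, x). c *\<^sub>R x) \<and>
     neighbourhood_base_of convex T \<and>
     Hausdorff_space T"

definition pi_base :: "'a topology \<Rightarrow> 'a set set \<Rightarrow> bool" where
  "pi_base X P \<longleftrightarrow>
     (\<forall>U\<in>P. openin X U \<and> U \<noteq> {}) \<and>
     (\<forall>V. openin X V \<and> V \<noteq> {} \<longrightarrow> (\<exists>U\<in>P. U \<subseteq> V))"

definition pseudocomplete :: "'a topology \<Rightarrow> bool" where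
  "pseudocomplete X \<longleftrightarrow>
     (\<exists>P :: nat \<Rightarrow> 'a set set. (\<forall>n. pi_base X (P n)) \<and>
        (\<forall>U. (\<forall>n. U n \<in> P n \<and> X closure_of U (Suc n) \<subseteq> U n) \<longrightarrow> (\<Inter>n. U n) \<noteq> {}))"

definition sigma_compact_space :: "'a topology \<Rightarrow> bool" where
  "sigma_compact_space X \<longleftrightarrow>
     (\<exists>\<C>. countable \<C> \<and> (\<forall>C\<in>\<C>. compactin X C) \<and> topspace X = \<Union>\<C>)"

definition closed_vector_subspace :: "'a::real_vector topology \<Rightarrow> 'a set \<Rightarrow> bool" where
  "closed_vector_subspace T S \<longleftrightarrow> subspace S \<and> closedin T S"

end

theory Submission
  imports Defs "HOL-Library.Countable_Set_Type"
begin

text \<open>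
  Let \<open>I\<close> be a set of $\omega_1$ reals and identify $\mathbb R^I$ with the functions on the reals that vanish off \<open>I\<close>.
  The finitely supported functions form a \<open>\<sigma>\<close>-compact, non-separable subspace \<open>E\<close>, and if
  \<open>E = K \<inter> L\<close> then the diagonal of \<open>E\<close> is closed in \<open>K \<times> L\<close>. So it suffices to find two subspaces of
  $\mathbb R^I$ that meet exactly in \<open>E\<close> and have all the required properties. Every closed subspace \<open>F\<close> of
  $\mathbb R^I$ is the range of a projection given by a row-finite matrix \<open>a\<close>, and \<open>K \<inter> F\<close> is separable as
  soon as \<open>K\<close> meets the sets of all \<open>y + a v\<close> with \<open>v\<close> uniformly small, for a countable dense set of
  points \<open>y\<close> of \<open>F\<close>. Sets of the same shape force \<open>K\<close> to project onto every countable subproduct, which gives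
  pseudocompleteness. By $2^{\omega_1} = \mathfrak c$ there are only continuum many such sets, and none is contained in the
  span of fewer than continuum many vectors, so a transfinite recursion of length $\mathfrak c$ picks a point
  of each set twice, once for \<open>K\<close> and once for \<open>L\<close>, with all these points independent modulo \<open>E\<close>.
\<close>

section \<open>Real-valued functions with the product topology\<close>

definition supported_on :: "'i set \<Rightarrow> ('i \<Rightarrow> real) set" where
  "supported_on I = {x. \<forall>i. i \<notin> I \<longrightarrow> x i = 0}"

definition finitely_supported_on :: "'i set \<Rightarrow> ('i \<Rightarrow> real) set" where
  "finitely_supported_on I = {x \<in> supported_on I. finite {i. x i \<noteq> 0}}"

definition unit_fun :: "'i \<Rightarrow> 'i \<Rightarrow> real" where
  "unit_fun i = (\<lambda>k. if k = i then 1 else 0)"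

text \<open>Finitely supported functions form the continuous dual of a product of lines, and this is
  the duality. The value is meaningful for finitely supported \<open>\<phi>\<close> only: a sum over
  an infinite set is 0 by convention.\<close>

definition pairing :: "('i \<Rightarrow> real) \<Rightarrow> ('i \<Rightarrow> real) \<Rightarrow> real" where
  "pairing \<phi> x = (\<Sum>i | \<phi> i \<noteq> 0. \<phi> i * x i)"

lemma scaleR_fun_apply [simp]: "(c *\<^sub>R f) x = c *\<^sub>R f x"
  by (simp add: scaleR_fun_def)

lemma sum_fun_apply: "(\<Sum>a\<in>A. f a) x = (\<Sum>a\<in>A. f a x)"
  by (induction A rule: infinite_finite_induct) auto

lemma unit_fun_apply [simp]: "unit_fun i i = 1" "k \<noteq> i \<Longrightarrow> unit_fun i k = 0"
  by (auto simp: unit_fun_def)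

section \<open>Neighbourhoods and closures in the product topology\<close>

lemma open_fun_contains_box:
  fixes x :: "'i \<Rightarrow> real"
  assumes "open U" "x \<in> U"
  obtains A e where "finite A" "e > 0" "\<And>y. \<forall>i\<in>A. \<bar>y i - x i\<bar> < e \<Longrightarrow> y \<in> U"
proof -
  obtain X where X: "x \<in> Pi\<^sub>E UNIV X" "\<And>i. open (X i)" "finite {i. X i \<noteq> UNIV}" "Pi\<^sub>E UNIV X \<subseteq> U"
    using product_topology_open_contains_basis[of "\<lambda>_. euclidean" UNIV U x] assms
    by (auto simp: open_fun_def)
  have "\<forall>i. \<exists>e>0. \<forall>y. \<bar>y - x i\<bar> < e \<longrightarrow> y \<in> X i"
    using X(1,2) by (auto simp: open_real PiE_iff)
  then obtain e where e: "\<And>i. e i > 0" "\<And>i y. \<bar>y - x i\<bar> < e i \<Longrightarrow> y \<in> X i"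
    by metis
  let ?A = "{i. X i \<noteq> UNIV}"
  show thesis
  \<comment> \<open>The smallest radius of the finitely many proper factors serves for all of them;
    \<open>insert 1\<close> keeps the minimum defined when there are none.\<close>
  proof (rule that[of ?A "Min (insert 1 (e ` ?A))"])
    fix y assume y: "\<forall>i\<in>?A. \<bar>y i - x i\<bar> < Min (insert 1 (e ` ?A))"
    have "y i \<in> X i" for i
    proof (cases "i \<in> ?A")
      case True
      then show ?thesis using bspec[OF y True] X(3) by (intro e(2)) auto
    qed auto
    then show "y \<in> U" using X(4) by (auto simp: PiE_iff)
  qed (use X(3) e(1) in auto)
qed

lemma open_box: "finite A \<Longrightarrow> open {x::'i \<Rightarrow> real. \<forall>i\<in>A. l i < x i \<and> x i < u i}"
  using product_topology_basis'[of A "\<lambda>i. {l i<..<u i}" id] by simp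

text \<open>The form in which all later density arguments are run: approximation at finitely many
  coordinates with one tolerance.\<close>

lemma in_closure_fun_iff:
  fixes x :: "'i \<Rightarrow> real"
  shows "x \<in> closure S \<longleftrightarrow> (\<forall>A e. finite A \<longrightarrow> e > 0 \<longrightarrow> (\<exists>y\<in>S. \<forall>i\<in>A. \<bar>y i - x i\<bar> < e))"
proof
  assume x: "x \<in> closure S"
  show "\<forall>A e. finite A \<longrightarrow> e > 0 \<longrightarrow> (\<exists>y\<in>S. \<forall>i\<in>A. \<bar>y i - x i\<bar> < e)"
  proof (intro allI impI)
    fix A :: "'i set" and e :: real assume A: "finite A" "e > 0"
    define U where "U = {y. \<forall>i\<in>A. x i - e < y i \<and> y i < x i + e}"
    have "open U" "x \<in> U"
      using open_box[OF A(1), of "\<lambda>i. x i - e" "\<lambda>i. x i + e"] A(2) by (auto simp: U_def)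
    then obtain y where "y \<in> S" "y \<in> U"
      using x by (metis disjoint_iff open_Int_closure_eq_empty)
    then show "\<exists>y\<in>S. \<forall>i\<in>A. \<bar>y i - x i\<bar> < e"
      by (intro bexI[of _ y]) (fastforce simp: U_def abs_less_iff)+
  qed
next
  assume R: "\<forall>A e. finite A \<longrightarrow> e > 0 \<longrightarrow> (\<exists>y\<in>S. \<forall>i\<in>A. \<bar>y i - x i\<bar> < e)"
  show "x \<in> closure S"
  proof (rule ccontr)
    assume "x \<notin> closure S"
    then have "x \<in> - closure S" "open (- closure S)" by auto
    then obtain A e where A: "finite A" "e > 0" "\<And>y. \<forall>i\<in>A. \<bar>y i - x i\<bar> < e \<Longrightarrow> y \<in> - closure S"
      using open_fun_contains_box by metis
    then obtain y where "y \<in> S" "\<forall>i\<in>A. \<bar>y i - x i\<bar> < e" using R by blast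
    then show False using A(3)[of y] closure_subset by blast
  qed
qed

lemma Hausdorff_space_euclidean_fun: "Hausdorff_space (euclidean :: ('i \<Rightarrow> real) topology)"
  unfolding euclidean_product_topology[symmetric]
  by (simp add: Hausdorff_space_product_topology)

lemma continuous_map_into_euclidean_fun:
  "continuous_map X (euclidean :: ('i \<Rightarrow> real) topology) f \<longleftrightarrow> (\<forall>i. continuous_map X euclideanreal (\<lambda>x. f x i))"
  unfolding euclidean_product_topology[symmetric] by (rule continuous_map_componentwise_UNIV)

lemma continuous_map_fun_coordinate:
  assumes "continuous_map X (subtopology (euclidean :: ('i \<Rightarrow> real) topology) S) f"
  shows "continuous_map X euclideanreal (\<lambda>x. f x i)"
  using assms by (simp add: continuous_map_in_subtopology continuous_map_into_euclidean_fun)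

text \<open>The operations are continuous because they are so in each coordinate; boxes cut with
  \<open>K\<close> supply the convex neighbourhoods.\<close>

lemma locally_convex_space_subtopology_fun:
  fixes K :: "('i \<Rightarrow> real) set"
  assumes K: "subspace K"
  shows "locally_convex_space (subtopology euclidean K)"
  unfolding locally_convex_space_def
proof (intro conjI)
  let ?T = "subtopology euclidean K"
  have co: "continuous_map (prod_topology X ?T) euclideanreal (\<lambda>p. snd p i)" for X :: "'x topology" and i
    by (rule continuous_map_fun_coordinate[OF continuous_map_snd])
  have co1: "continuous_map (prod_topology ?T X) euclideanreal (\<lambda>p. fst p i)" for X :: "'x topology" and i
    by (rule continuous_map_fun_coordinate[OF continuous_map_fst])
  show "subspace (topspace ?T)" using K by simp
  have "continuous_map (prod_topology ?T ?T) euclidean (\<lambda>p. fst p + snd p)"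
    unfolding continuous_map_into_euclidean_fun plus_fun_apply
    by (intro allI, rule continuous_map_add[OF co1 co])
  moreover have "(\<lambda>p. fst p + snd p) \<in> topspace (prod_topology ?T ?T) \<rightarrow> K"
    by (rule Pi_I, rule subspace_add[OF K])
      (simp_all only: topspace_prod_topology topspace_euclidean_subtopology mem_Times_iff)
  ultimately show "continuous_map (prod_topology ?T ?T) ?T (\<lambda>(x, y). x + y)"
    unfolding continuous_map_in_subtopology case_prod_unfold by (rule conjI)
  have "continuous_map (prod_topology euclideanreal ?T) euclidean (\<lambda>p. fst p *\<^sub>R snd p)"
    unfolding continuous_map_into_euclidean_fun scaleR_fun_apply real_scaleR_def
    by (intro allI, rule continuous_map_real_mult[OF continuous_map_fst co])
  moreover have "(\<lambda>p. fst p *\<^sub>R snd p) \<in> topspace (prod_topology euclideanreal ?T) \<rightarrow> K"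
    by (rule Pi_I, rule subspace_scale[OF K])
      (simp only: topspace_prod_topology topspace_euclidean_subtopology mem_Times_iff)
  ultimately show "continuous_map (prod_topology euclideanreal ?T) ?T (\<lambda>(c, x). c *\<^sub>R x)"
    unfolding continuous_map_in_subtopology case_prod_unfold by (rule conjI)
  show "Hausdorff_space ?T"
    by (rule Hausdorff_space_subtopology[OF Hausdorff_space_euclidean_fun])
  show "neighbourhood_base_of convex ?T"
    unfolding neighbourhood_base_of
  proof (intro allI impI)
    fix W x assume W: "openin ?T W \<and> x \<in> W"
    then obtain U where U: "open U" "W = U \<inter> K" by (auto simp: openin_subtopology)
    then obtain A e where A: "finite A" "e > 0" "\<And>y. \<forall>i\<in>A. \<bar>y i - x i\<bar> < e \<Longrightarrow> y \<in> U"
      using W open_fun_contains_box by (metis IntD1)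
    define B where "B = {y. \<forall>i\<in>A. x i - e < y i \<and> y i < x i + e}"
    have 1: "open B" unfolding B_def by (rule open_box[OF A(1)])
    have "convex B"
      unfolding B_def convex_def
    proof clarsimp
      fix y z :: "'i \<Rightarrow> real" and u v :: real and i
      assume *: "\<forall>i\<in>A. x i - e < y i \<and> y i < x i + e" "\<forall>i\<in>A. x i - e < z i \<and> z i < x i + e"
        "0 \<le> u" "0 \<le> v" "u + v = 1" "i \<in> A"
      have "convex {x i - e <..< x i + e}" by simp
      then show "x i - e < u * y i + v * z i \<and> u * y i + v * z i < x i + e"
        using * unfolding convex_def by force
    qed
    then have 2: "convex (B \<inter> K)" using K subspace_imp_convex convex_Int by blast
    have 3: "x \<in> B" "B \<inter> K \<subseteq> W"
      using A(2) U(2) A(3) by (force simp: B_def abs_less_iff)+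
    show "\<exists>V C. openin ?T V \<and> convex C \<and> x \<in> V \<and> V \<subseteq> C \<and> C \<subseteq> W"
      using 1 2 3 W U by (intro exI[of _ "B \<inter> K"]) (auto simp: openin_subtopology)
  qed
qed

section \<open>Closed subspaces of products of lines\<close>

lemma subspace_supported_on: "subspace (supported_on I)"
  by (auto simp: subspace_def supported_on_def)

lemma subspace_finitely_supported_on: "subspace (finitely_supported_on I)"
  unfolding subspace_def
proof (intro conjI ballI allI)
  fix x y :: "'a \<Rightarrow> real" assume "x \<in> finitely_supported_on I" "y \<in> finitely_supported_on I"
  moreover have "{i. (x + y) i \<noteq> 0} \<subseteq> {i. x i \<noteq> 0} \<union> {i. y i \<noteq> 0}" by auto
  ultimately show "x + y \<in> finitely_supported_on I"
    by (auto simp: finitely_supported_on_def supported_on_def intro: finite_subset)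
next
  fix c :: real and x :: "'a \<Rightarrow> real" assume "x \<in> finitely_supported_on I"
  moreover have "{i. (c *\<^sub>R x) i \<noteq> 0} \<subseteq> {i. x i \<noteq> 0}" by auto
  ultimately show "c *\<^sub>R x \<in> finitely_supported_on I"
    by (auto simp: finitely_supported_on_def supported_on_def intro: finite_subset)
qed (auto simp: finitely_supported_on_def supported_on_def)

lemma finitely_supported_expansion:
  assumes "finite A" "\<And>i. i \<notin> A \<Longrightarrow> x i = 0"
  shows "x = (\<Sum>i\<in>A. x i *\<^sub>R unit_fun i)"
  using assms by (auto simp: fun_eq_iff sum_fun_apply unit_fun_def if_distrib cong: if_cong)

lemma finitely_supported_on_eq_span: "finitely_supported_on I = span (unit_fun ` I)"
proof
  show "span (unit_fun ` I) \<subseteq> finitely_supported_on I"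
    by (intro span_minimal subspace_finitely_supported_on)
      (auto simp: finitely_supported_on_def supported_on_def unit_fun_def)
  show "finitely_supported_on I \<subseteq> span (unit_fun ` I)"
  proof
    fix x assume x: "x \<in> finitely_supported_on I"
    then have "x = (\<Sum>i\<in>{i. x i \<noteq> 0}. x i *\<^sub>R unit_fun i)"
      by (intro finitely_supported_expansion) (auto simp: finitely_supported_on_def)
    also have "\<dots> \<in> span (unit_fun ` I)"
      using x by (intro span_sum span_scale span_base) (auto simp: finitely_supported_on_def supported_on_def)
    finally show "x \<in> span (unit_fun ` I)" .
  qed
qed

section \<open>Bilinearity of the pairing\<close>

lemma pairing_eq_sum:
  assumes "finite A" "\<And>i. i \<notin> A \<Longrightarrow> \<phi> i = 0"
  shows "pairing \<phi> x = (\<Sum>i\<in>A. \<phi> i * x i)"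
  unfolding pairing_def using assms by (intro sum.mono_neutral_left) auto

lemma pairing_unit_fun [simp]: "pairing (unit_fun i) x = x i"
  by (subst pairing_eq_sum[of "{i}"]) auto

lemma pairing_zero_left [simp]: "pairing (\<lambda>i. 0) x = 0" "pairing 0 x = 0"
  by (auto simp: pairing_def)

lemma pairing_zero_right [simp]: "pairing \<phi> 0 = 0" "pairing \<phi> (\<lambda>i. 0) = 0"
  by (auto simp: pairing_def)

lemma pairing_add_right: "pairing \<phi> (x + y) = pairing \<phi> x + pairing \<phi> y"
  by (simp add: pairing_def sum.distrib algebra_simps)

lemma pairing_diff_right: "pairing \<phi> (x - y) = pairing \<phi> x - pairing \<phi> y"
  by (simp add: pairing_def sum_subtractf algebra_simps)

lemma pairing_scale_right: "pairing \<phi> (c *\<^sub>R x) = c * pairing \<phi> x"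
  by (simp add: pairing_def sum_distrib_left algebra_simps)

text \<open>Additivity on the right holds for all \<open>\<phi>\<close>, but here supports must be
  finite: infinite supports pair to 0 and yet may cancel to a finite one.\<close>

lemma pairing_add_left:
  assumes "finite {i. \<phi> i \<noteq> 0}" "finite {i. \<psi> i \<noteq> 0}"
  shows "pairing (\<phi> + \<psi>) x = pairing \<phi> x + pairing \<psi> x"
proof -
  let ?A = "{i. \<phi> i \<noteq> 0} \<union> {i. \<psi> i \<noteq> 0}"
  have "pairing (\<phi> + \<psi>) x = (\<Sum>i\<in>?A. (\<phi> + \<psi>) i * x i)" using assms by (intro pairing_eq_sum) auto
  moreover have "pairing \<phi> x = (\<Sum>i\<in>?A. \<phi> i * x i)" using assms by (intro pairing_eq_sum) auto
  moreover have "pairing \<psi> x = (\<Sum>i\<in>?A. \<psi> i * x i)" using assms by (intro pairing_eq_sum) auto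
  ultimately show ?thesis by (simp add: algebra_simps sum.distrib)
qed

lemma pairing_scale_left: "pairing (c *\<^sub>R \<phi>) x = c * pairing \<phi> x"
  by (cases "c = 0") (auto simp: pairing_def sum_distrib_left algebra_simps)

lemma pairing_sum_left:
  assumes "\<And>a. a \<in> A \<Longrightarrow> finite {i. \<phi> a i \<noteq> 0}"
  shows "pairing (\<Sum>a\<in>A. \<phi> a) x = (\<Sum>a\<in>A. pairing (\<phi> a) x)"
  using assms
proof (induction A rule: infinite_finite_induct)
  case (insert a A)
  have "(\<Sum>a\<in>A. \<phi> a) \<in> finitely_supported_on UNIV"
    using insert.prems
    by (intro subspace_sum subspace_finitely_supported_on) (auto simp: finitely_supported_on_def supported_on_def)
  then have "finite {i. (\<Sum>a\<in>A. \<phi> a) i \<noteq> 0}" by (simp add: finitely_supported_on_def)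
  moreover have "finite {i. \<phi> a i \<noteq> 0}" using insert.prems by simp
  ultimately have "pairing (\<phi> a + (\<Sum>a\<in>A. \<phi> a)) x = pairing (\<phi> a) x + pairing (\<Sum>a\<in>A. \<phi> a) x"
    by (intro pairing_add_left)
  then show ?case using insert.hyps insert.IH insert.prems by (simp only: sum.insert insert_iff simp_thms)
qed auto

section \<open>Annihilators and separation\<close>

definition annihilator :: "'i set \<Rightarrow> ('i \<Rightarrow> real) set \<Rightarrow> ('i \<Rightarrow> real) set" where
  "annihilator I F = {\<phi> \<in> finitely_supported_on I. \<forall>x\<in>F. pairing \<phi> x = 0}"

lemma subspace_annihilator: "subspace (annihilator I F)"
  using subspace_finitely_supported_on[of I]
  by (auto simp: subspace_def annihilator_def finitely_supported_on_def pairing_add_left pairing_scale_left)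

text \<open>Restriction to \<open>A\<close> reduces this to linear algebra: a functional can be
  prescribed on a basis of the image of \<open>F\<close> together with \<open>\<rho> x\<close>,
  since \<open>\<rho> x\<close> is outside that image.\<close>

lemma finite_coordinate_separation:
  fixes F :: "('i \<Rightarrow> real) set"
  assumes F: "subspace F" and A: "finite A" and x: "\<not> (\<exists>y\<in>F. \<forall>i\<in>A. y i = x i)"
  obtains \<phi> where "\<And>i. i \<notin> A \<Longrightarrow> \<phi> i = 0" "\<And>y. y \<in> F \<Longrightarrow> pairing \<phi> y = 0" "pairing \<phi> x \<noteq> 0"
proof -
  define \<rho> :: "('i \<Rightarrow> real) \<Rightarrow> 'i \<Rightarrow> real" where "\<rho> y = (\<lambda>i. if i \<in> A then y i else 0)" for y
  have lin: "linear \<rho>" by (rule linearI) (auto simp: \<rho>_def fun_eq_iff)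
  have sub: "subspace (\<rho> ` F)" by (rule linear_subspace_image[OF lin F])
  obtain B where B: "B \<subseteq> \<rho> ` F" "independent B" "\<rho> ` F \<subseteq> span B"
    using maximal_independent_subset by blast
  have "\<rho> x \<notin> \<rho> ` F"
  proof
    assume "\<rho> x \<in> \<rho> ` F"
    then obtain y where y: "y \<in> F" "\<rho> x = \<rho> y" by blast
    have "y i = x i" if "i \<in> A" for i using fun_cong[OF y(2), of i] that by (simp add: \<rho>_def)
    then show False using x y(1) by blast
  qed
  moreover have "span B \<subseteq> \<rho> ` F" using B(1) sub span_minimal by blast
  ultimately have nx: "\<rho> x \<notin> span B" by blast
  then have "independent (insert (\<rho> x) B)" using B(2) by (simp add: independent_insertI)
  then obtain g :: "('i \<Rightarrow> real) \<Rightarrow> real" where g: "linear g" "\<And>b. b \<in> insert (\<rho> x) B \<Longrightarrow> g b = (if b = \<rho> x then 1 else 0)"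
    using linear_independent_extend[of "insert (\<rho> x) B" "\<lambda>b. if b = \<rho> x then 1 else (0::real)"] by blast
  have gB: "g z = 0" if "z \<in> span B" for z
  proof (rule linear_eq_0_on_span[OF g(1) _ that])
    fix b assume b: "b \<in> B"
    then have "b \<noteq> \<rho> x" using nx span_base by metis
    then show "g b = 0" using g(2)[of b] b by simp
  qed
  \<comment> \<open>The coefficients are the values of \<open>g\<close> on the unit functions of
    \<open>A\<close>, so that pairing with \<open>\<phi>\<close> is \<open>g\<close> after
    \<open>\<rho>\<close>.\<close>
  define \<phi> where "\<phi> = (\<lambda>i. if i \<in> A then g (unit_fun i) else 0)"
  have \<phi>: "pairing \<phi> y = g (\<rho> y)" for y
  proof -
    have "\<rho> y = (\<Sum>i\<in>A. \<rho> y i *\<^sub>R unit_fun i)"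
      by (rule finitely_supported_expansion[OF A]) (auto simp: \<rho>_def)
    then have "g (\<rho> y) = g (\<Sum>i\<in>A. \<rho> y i *\<^sub>R unit_fun i)" by simp
    also have "\<dots> = (\<Sum>i\<in>A. \<rho> y i * g (unit_fun i))"
      by (simp add: linear_sum[OF g(1)] linear_scale[OF g(1)])
    also have "\<dots> = pairing \<phi> y"
      by (subst pairing_eq_sum[OF A]) (auto simp: \<phi>_def \<rho>_def intro!: sum.cong)
    finally show ?thesis by simp
  qed
  show thesis
  proof (rule that[of \<phi>])
    show "pairing \<phi> y = 0" if "y \<in> F" for y unfolding \<phi> using that B(3) by (intro gB) blast
    show "pairing \<phi> x \<noteq> 0" unfolding \<phi> using g(2)[of "\<rho> x"] by simp
  qed (simp add: \<phi>_def)
qed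

text \<open>Closedness yields finitely many coordinates on which no member of \<open>F\<close> is
  close to \<open>x\<close>, let alone equal to it. This reduces Hahn-Banach separation to the case
  of finitely many coordinates.\<close>

lemma annihilator_separates:
  assumes F: "subspace F" "closed F" "F \<subseteq> supported_on I" and x: "x \<in> supported_on I" "x \<notin> F"
  obtains \<phi> where "\<phi> \<in> annihilator I F" "pairing \<phi> x \<noteq> 0"
proof -
  have "x \<notin> closure F" using F(2) x(2) by simp
  then obtain A e where A: "finite A" "e > 0" "\<And>y. y \<in> F \<Longrightarrow> \<exists>i\<in>A. \<not> \<bar>y i - x i\<bar> < e"
    unfolding in_closure_fun_iff by blast
  \<comment> \<open>Both \<open>x\<close> and the members of \<open>F\<close> vanish off
    \<open>I\<close>, so only coordinates in \<open>A \<inter> I\<close> can tell them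
    apart.\<close>
  have "\<not> (\<exists>y\<in>F. \<forall>i\<in>A \<inter> I. y i = x i)"
  proof
    assume "\<exists>y\<in>F. \<forall>i\<in>A \<inter> I. y i = x i"
    then obtain y where y: "y \<in> F" "\<And>i. i \<in> A \<Longrightarrow> i \<in> I \<Longrightarrow> y i = x i" by blast
    then obtain i where i: "i \<in> A" "\<not> \<bar>y i - x i\<bar> < e" using A(3) by blast
    have "y i = x i" using y i(1) F(3) x(1) by (cases "i \<in> I") (auto simp: supported_on_def)
    then show False using i A(2) by simp
  qed
  then obtain \<phi> where \<phi>: "\<And>i. i \<notin> A \<inter> I \<Longrightarrow> \<phi> i = 0" "\<And>y. y \<in> F \<Longrightarrow> pairing \<phi> y = 0" "pairing \<phi> x \<noteq> 0"
    using finite_coordinate_separation[OF F(1), of "A \<inter> I"] A(1) by blast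
  have "{i. \<phi> i \<noteq> 0} \<subseteq> A" using \<phi>(1) by auto
  then have "\<phi> \<in> annihilator I F"
    using \<phi> A(1) by (auto simp: annihilator_def finitely_supported_on_def supported_on_def intro: finite_subset)
  then show thesis using \<phi>(3) that by blast
qed

text \<open>\<open>J\<close> indexes a basis of the finitely supported functions modulo \<open>N\<close> made of unit functions.\<close>

lemma maximal_free_coordinates:
  assumes N: "subspace N" "N \<subseteq> finitely_supported_on I"
  obtains J where "J \<subseteq> I" "\<And>\<phi>. \<phi> \<in> N \<Longrightarrow> \<phi> \<in> supported_on J \<Longrightarrow> \<phi> = 0"
    "\<And>i. i \<in> I \<Longrightarrow> i \<notin> J \<Longrightarrow> \<exists>\<phi>\<in>N. \<phi> i = 1 \<and> \<phi> \<in> supported_on (insert i J)"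
proof -
  define free where "free J \<longleftrightarrow> J \<subseteq> I \<and> (\<forall>\<phi>\<in>N. \<phi> \<in> supported_on J \<longrightarrow> \<phi> = 0)" for J
  have freeD: "\<phi> = 0" if "free J" "\<phi> \<in> N" "\<phi> \<in> supported_on J" for J \<phi>
    using that unfolding free_def by blast
  have "\<exists>J\<in>Collect free. \<forall>X\<in>Collect free. J \<subseteq> X \<longrightarrow> X = J"
  proof (rule subset_Zorn_nonempty)
    have "\<phi> = 0" if "\<phi> \<in> supported_on {}" for \<phi> :: "'a \<Rightarrow> real"
      using that unfolding supported_on_def fun_eq_iff by simp
    then have "free {}" unfolding free_def by blast
    then show "Collect free \<noteq> {}" by blast
  next
    fix C assume C: "C \<noteq> {}" "subset.chain (Collect free) C"
    then have C_free: "free J" if "J \<in> C" for J using that unfolding subset_chain_def by blast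
    have "\<phi> = 0" if \<phi>: "\<phi> \<in> N" "\<phi> \<in> supported_on (\<Union>C)" for \<phi>
    proof -
      \<comment> \<open>Unions of chains stay free because supports are finite: a finite subset of
        the union lies in one member of the chain.\<close>
      have "finite {i. \<phi> i \<noteq> 0}" using \<phi>(1) N(2) unfolding finitely_supported_on_def by blast
      moreover have "{i. \<phi> i \<noteq> 0} \<subseteq> \<Union>C" using \<phi>(2) unfolding supported_on_def by blast
      ultimately obtain J where J: "J \<in> C" "{i. \<phi> i \<noteq> 0} \<subseteq> J"
        by (rule finite_subset_Union_chain[OF _ _ C])
      then have "\<phi> \<in> supported_on J" unfolding supported_on_def by blast
      then show ?thesis by (rule freeD[OF C_free[OF J(1)] \<phi>(1)])
    qed
    moreover have "\<Union>C \<subseteq> I" using C_free unfolding free_def by blast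
    ultimately have "free (\<Union>C)" unfolding free_def by blast
    then show "\<Union>C \<in> Collect free" by simp
  qed
  then obtain J where J: "free J" and max: "\<And>X. free X \<Longrightarrow> J \<subseteq> X \<Longrightarrow> X = J"
    by (simp only: Bex_def Ball_def mem_Collect_eq) blast
  have JI: "J \<subseteq> I" using J unfolding free_def by blast
  show thesis
  proof (rule that[OF JI freeD[OF J]])
    fix i assume i: "i \<in> I" "i \<notin> J"
    have "\<not> free (insert i J)"
    proof
      assume "free (insert i J)"
      then have "insert i J = J" by (rule max) blast
      then show False using i(2) by blast
    qed
    then obtain \<phi> where \<phi>: "\<phi> \<in> N" "\<phi> \<in> supported_on (insert i J)" "\<phi> \<noteq> 0"
      using i(1) JI free_def[of "insert i J"] insert_subset[of i J I] by metis
    \<comment> \<open>The relation that destroys freeness must involve \<open>i\<close>, since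
      otherwise it would already be supported on \<open>J\<close>. Division by this coefficient
      normalises it.\<close>
    have "\<phi> i \<noteq> 0"
    proof
      assume "\<phi> i = 0"
      then have "\<phi> \<in> supported_on J"
        using \<phi>(2) unfolding supported_on_def mem_Collect_eq by (metis insert_iff)
      then show False using freeD[OF J \<phi>(1)] \<phi>(3) by blast
    qed
    then have "((1 / \<phi> i) *\<^sub>R \<phi>) i = 1" by simp
    moreover have "(1 / \<phi> i) *\<^sub>R \<phi> \<in> N" using \<phi>(1) N(1) by (rule subspace_scale[rotated])
    moreover have "(1 / \<phi> i) *\<^sub>R \<phi> \<in> supported_on (insert i J)"
      by (rule subspace_scale[OF subspace_supported_on \<phi>(2)])
    ultimately show "\<exists>\<phi>\<in>N. \<phi> i = 1 \<and> \<phi> \<in> supported_on (insert i J)" by blast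
  qed
qed

text \<open>These matrices are the continuous linear maps of the product of \<open>I\<close> lines
  into itself. Rows off \<open>I\<close> are zero so that all values vanish there.\<close>

definition row_finite_on :: "'i set \<Rightarrow> ('i \<Rightarrow> 'i \<Rightarrow> real) \<Rightarrow> bool" where
  "row_finite_on I a \<longleftrightarrow> (\<forall>i\<in>I. a i \<in> finitely_supported_on I) \<and> (\<forall>i. i \<notin> I \<longrightarrow> a i = 0)"

definition mat_apply :: "('i \<Rightarrow> 'i \<Rightarrow> real) \<Rightarrow> ('i \<Rightarrow> real) \<Rightarrow> 'i \<Rightarrow> real" where
  "mat_apply a x = (\<lambda>i. pairing (a i) x)"

text \<open>On \<open>F\<close> the coordinates in \<open>J\<close> are free and each other
  coordinate in \<open>I\<close> is a finite combination of them. These combinations are the rows of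
  the projection.\<close>

theorem closed_subspace_projection:
  fixes F :: "('i \<Rightarrow> real) set"
  assumes F: "subspace F" "closed F" "F \<subseteq> supported_on I"
  obtains a J where "J \<subseteq> I" "row_finite_on I a" "\<And>j. j \<in> J \<Longrightarrow> a j = unit_fun j"
    "\<And>i. a i \<in> supported_on J" "\<And>x. mat_apply a x \<in> F" "\<And>x. x \<in> F \<Longrightarrow> mat_apply a x = x"
proof -
  let ?N = "annihilator I F"
  have N: "subspace ?N" "?N \<subseteq> finitely_supported_on I"
    using subspace_annihilator by (auto simp: annihilator_def)
  obtain J where J: "J \<subseteq> I" "\<And>\<phi>. \<phi> \<in> ?N \<Longrightarrow> \<phi> \<in> supported_on J \<Longrightarrow> \<phi> = 0"
    "\<And>i. i \<in> I \<Longrightarrow> i \<notin> J \<Longrightarrow> \<exists>\<phi>\<in>?N. \<phi> i = 1 \<and> \<phi> \<in> supported_on (insert i J)"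
    using maximal_free_coordinates[OF N] by metis
  have "\<forall>i\<in>I - J. \<exists>\<phi>. \<phi> \<in> ?N \<and> \<phi> i = 1 \<and> \<phi> \<in> supported_on (insert i J)" using J(3) by blast
  then obtain \<psi> where \<psi>: "\<And>i. i \<in> I - J \<Longrightarrow> \<psi> i \<in> ?N \<and> \<psi> i i = 1 \<and> \<psi> i \<in> supported_on (insert i J)"
    by metis
  \<comment> \<open>Since \<open>\<psi> i\<close> annihilates \<open>F\<close> and has coefficient 1
    at \<open>i\<close>, coordinate \<open>i\<close> agrees on \<open>F\<close> with the pairing
    with \<open>unit_fun i - \<psi> i\<close>, which involves \<open>J\<close> only.\<close>
  define a where "a i = (if i \<in> J then unit_fun i else if i \<in> I then unit_fun i - \<psi> i else 0)" for i
  have unitI: "unit_fun i \<in> finitely_supported_on I" if "i \<in> I" for i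
    using that by (auto simp: finitely_supported_on_eq_span span_base)
  have dN: "unit_fun i - a i \<in> ?N" if "i \<in> I" for i
    using that \<psi>[of i] N(1) by (auto simp: a_def subspace_0)
  have aI: "a i \<in> finitely_supported_on I" if "i \<in> I" for i
    using that \<psi>[of i] N(2) J(1) unitI subspace_finitely_supported_on[of I]
    by (auto simp: a_def intro!: subspace_diff)
  have aJ: "a i \<in> supported_on J" for i
    using \<psi>[of i] by (auto simp: a_def supported_on_def unit_fun_def)
  have fix_F: "mat_apply a x = x" if x: "x \<in> F" for x
  proof
    fix i
    show "mat_apply a x i = x i"
    proof (cases "i \<in> I")
      case True
      have "pairing (unit_fun i) x = pairing (a i + (unit_fun i - a i)) x" by simp
      also have "\<dots> = pairing (a i) x + pairing (unit_fun i - a i) x"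
        using aI[OF True] dN[OF True] by (intro pairing_add_left) (auto simp: finitely_supported_on_def annihilator_def)
      also have "pairing (unit_fun i - a i) x = 0" using dN[OF True] x by (auto simp: annihilator_def)
      finally show ?thesis by (simp add: mat_apply_def)
    next
      case False
      then show ?thesis using x F(3) J(1) by (auto simp: mat_apply_def a_def supported_on_def)
    qed
  qed
  have into_F: "mat_apply a x \<in> F" for x
  proof (rule ccontr)
    assume "mat_apply a x \<notin> F"
    moreover have "mat_apply a x \<in> supported_on I"
      using J(1) by (auto simp: mat_apply_def supported_on_def a_def)
    ultimately obtain \<phi> where \<phi>: "\<phi> \<in> ?N" "pairing \<phi> (mat_apply a x) \<noteq> 0"
      using annihilator_separates[OF F] by metis
    let ?A = "{i. \<phi> i \<noteq> 0}"
    have A: "finite ?A" "?A \<subseteq> I"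
      using \<phi>(1) by (auto simp: annihilator_def finitely_supported_on_def supported_on_def)
    \<comment> \<open>\<open>\<eta>\<close> is \<open>\<phi>\<close> composed with \<open>a\<close>.
      It differs from \<open>\<phi>\<close> by a member of the annihilator, hence annihilates
      \<open>F\<close>; being supported on \<open>J\<close>, it must vanish.\<close>
    define \<eta> where "\<eta> = (\<Sum>i\<in>?A. \<phi> i *\<^sub>R a i)"
    have "\<eta> = \<phi> - (\<Sum>i\<in>?A. \<phi> i *\<^sub>R (unit_fun i - a i))"
      unfolding \<eta>_def by (subst (2) finitely_supported_expansion[OF A(1), of \<phi>])
        (auto simp: scaleR_diff_right sum_subtractf)
    also have "\<dots> \<in> ?N"
    proof (rule subspace_diff[OF N(1) \<phi>(1)], rule subspace_sum[OF N(1)], rule subspace_scale[OF N(1)])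
      show "unit_fun i - a i \<in> ?N" if "i \<in> ?A" for i using that A(2) dN by blast
    qed
    finally have "\<eta> \<in> ?N" .
    moreover have "\<eta> \<in> supported_on J"
      unfolding \<eta>_def using aJ by (intro subspace_sum subspace_scale subspace_supported_on) auto
    ultimately have "\<eta> = 0" using J(2) by blast
    then have "0 = pairing \<eta> x" by simp
    also have "\<dots> = (\<Sum>i\<in>?A. pairing (\<phi> i *\<^sub>R a i) x)"
      unfolding \<eta>_def using A(2) aI by (intro pairing_sum_left) (auto simp: finitely_supported_on_def)
    also have "\<dots> = pairing \<phi> (mat_apply a x)"
      by (simp add: pairing_scale_left pairing_def[of \<phi>] mat_apply_def)
    finally show False using \<phi>(2) by simp
  qed
  show thesis
    by (rule that[of J a]) (use J(1) aI aJ fix_F into_F in \<open>auto simp: row_finite_on_def a_def\<close>)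
qed

section \<open>Density and separability\<close>

text \<open>Finite sums of rational multiples of indicators of rational intervals take almost any
  prescribed values at finitely many reals.\<close>

lemma countable_dense_real_functions:
  obtains D :: "(real \<Rightarrow> real) set" where "countable D" "closure D = UNIV"
proof -
  define step :: "(rat \<times> rat \<times> rat) list \<Rightarrow> real \<Rightarrow> real" where
    "step xs t = (\<Sum>(p, q, r) \<leftarrow> xs. if of_rat p < t \<and> t < of_rat q then of_rat r else 0)" for xs t
  have "\<exists>xs. \<forall>i\<in>A. \<bar>step xs i - x i\<bar> < e" if "finite A" "e > 0" for A x and e :: real
    using that
  proof (induction A)
    case (insert a A)
    then obtain xs where xs: "\<And>i. i \<in> A \<Longrightarrow> \<bar>step xs i - x i\<bar> < e" by blast
    \<comment> \<open>The new interval stays within \<open>d\<close> of \<open>a\<close>, so it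
      changes the sum at \<open>a\<close> but at no point of \<open>A\<close>.\<close>
    obtain d where d: "d > 0" "\<And>b. b \<in> A \<Longrightarrow> b \<noteq> a \<Longrightarrow> d \<le> dist a b"
      using finite_set_avoid[OF insert.hyps(1), of a] by blast
    obtain p where p: "a - d < of_rat p" "of_rat p < a" using of_rat_dense[of "a - d" a] d(1) by auto
    obtain q where q: "a < of_rat q" "of_rat q < a + d" using of_rat_dense[of a "a + d"] d(1) by auto
    obtain r where r: "x a - step xs a - e < of_rat r" "of_rat r < x a - step xs a + e"
      using of_rat_dense[of "x a - step xs a - e" "x a - step xs a + e"] insert.prems by auto
    have "\<bar>step ((p, q, r) # xs) i - x i\<bar> < e" if "i \<in> insert a A" for i
    proof (cases "i = a")
      case True
      then show ?thesis using p q r by (simp add: step_def abs_less_iff)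
    next
      case False
      then have "i \<in> A" "d \<le> dist a i" using that d(2) by auto
      then show ?thesis using xs[of i] p q by (auto simp: step_def dist_real_def)
    qed
    then show ?case by blast
  qed auto
  then have "closure (range step) = UNIV"
    by (auto simp: in_closure_fun_iff)
  then show thesis using that[of "range step"] by simp
qed

lemma closure_subspace_fun:
  fixes S :: "('i \<Rightarrow> real) set"
  assumes S: "subspace S"
  shows "subspace (closure S)"
  unfolding subspace_def
proof (intro conjI ballI allI)
  show "0 \<in> closure S" using S closure_subset subspace_0 by blast
next
  fix x y assume xy: "x \<in> closure S" "y \<in> closure S"
  show "x + y \<in> closure S"
    unfolding in_closure_fun_iff
  proof (intro allI impI)
    fix A :: "'i set" and e :: real assume A: "finite A" "e > 0"
    then have e2: "e / 2 > 0" by simp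
    obtain x' where x': "x' \<in> S" "\<forall>i\<in>A. \<bar>x' i - x i\<bar> < e / 2" using xy(1) A(1) e2 unfolding in_closure_fun_iff by blast
    obtain y' where y': "y' \<in> S" "\<forall>i\<in>A. \<bar>y' i - y i\<bar> < e / 2" using xy(2) A(1) e2 unfolding in_closure_fun_iff by blast
    have "\<bar>(x' + y') i - (x + y) i\<bar> < e" if "i \<in> A" for i
    proof -
      have "\<bar>x' i - x i\<bar> < e / 2" "\<bar>y' i - y i\<bar> < e / 2" using that x' y' by blast+
      then show ?thesis unfolding plus_fun_apply by linarith
    qed
    then show "\<exists>z\<in>S. \<forall>i\<in>A. \<bar>z i - (x + y) i\<bar> < e"
      using subspace_add[OF S x'(1) y'(1)] by blast
  qed
next
  fix c :: real and x assume x: "x \<in> closure S"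
  show "c *\<^sub>R x \<in> closure S"
    unfolding in_closure_fun_iff
  proof (intro allI impI)
    fix A :: "'i set" and e :: real assume A: "finite A" "e > 0"
    \<comment> \<open>The summand 1 avoids division by zero when \<open>c = 0\<close>.\<close>
    then have e2: "e / (\<bar>c\<bar> + 1) > 0" by simp
    obtain x' where x': "x' \<in> S" "\<forall>i\<in>A. \<bar>x' i - x i\<bar> < e / (\<bar>c\<bar> + 1)"
      using x A(1) e2 unfolding in_closure_fun_iff by blast
    have "\<bar>(c *\<^sub>R x') i - (c *\<^sub>R x) i\<bar> < e" if "i \<in> A" for i
    proof -
      have "\<bar>x' i - x i\<bar> < e / (\<bar>c\<bar> + 1)" using that x' by blast
      then have "\<bar>x' i - x i\<bar> * (\<bar>c\<bar> + 1) < e" by (simp add: pos_less_divide_eq)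
      moreover have "\<bar>c * x' i - c * x i\<bar> = \<bar>x' i - x i\<bar> * \<bar>c\<bar>"
        by (metis abs_mult mult.commute right_diff_distrib')
      ultimately show ?thesis by (simp add: distrib_left)
    qed
    then show "\<exists>z\<in>S. \<forall>i\<in>A. \<bar>z i - (c *\<^sub>R x) i\<bar> < e"
      using subspace_scale[OF S x'(1)] by blast
  qed
qed

lemma closed_supported_on: "closed (supported_on I)"
proof -
  have "x \<in> supported_on I" if x: "x \<in> closure (supported_on I)" for x :: "'a \<Rightarrow> real"
    unfolding supported_on_def
  proof (intro CollectI allI impI)
    fix i assume i: "i \<notin> I"
    show "x i = 0"
    proof (rule ccontr)
      assume "x i \<noteq> 0"
      then have "finite {i}" "\<bar>x i\<bar> > 0" by simp_all
      then obtain y where y: "y \<in> supported_on I" "\<forall>k\<in>{i}. \<bar>y k - x k\<bar> < \<bar>x i\<bar>"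
        using x unfolding in_closure_fun_iff by blast
      then have "y i = 0" using i unfolding supported_on_def by blast
      then show False using y(2) by simp
    qed
  qed
  then show ?thesis using closure_subset_eq by blast
qed

lemma separable_subtopology_fun:
  fixes S :: "('i \<Rightarrow> real) set"
  assumes "countable X" "X \<subseteq> S" "S \<subseteq> closure X"
  shows "separable_space (subtopology euclidean S)"
  unfolding separable_space_def
  using assms by (intro exI[of _ X]) (auto simp: closure_of_subtopology_subset closure_of_subtopology Int_absorb1)

text \<open>Induction on \<open>B\<close>: rational multiples of the new vector are added to the
  dense set obtained so far.\<close>

lemma finite_span_countable_dense:
  fixes B :: "('i \<Rightarrow> real) set"
  assumes "finite B"
  shows "\<exists>X. countable X \<and> X \<subseteq> span B \<and> span B \<subseteq> closure X"
  using assms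
proof (induction B)
  case empty
  show ?case by (intro exI[of _ "{0}"]) (simp add: closure_subset)
next
  case (insert b B)
  then obtain X where X: "countable X" "X \<subseteq> span B" "span B \<subseteq> closure X" by blast
  define Y where "Y = (\<lambda>(q, x). real_of_rat q *\<^sub>R b + x) ` (UNIV \<times> X)"
  have "countable Y" unfolding Y_def using X(1) by blast
  moreover have "Y \<subseteq> span (insert b B)"
  proof
    fix y assume "y \<in> Y"
    then obtain q x where y: "y = real_of_rat q *\<^sub>R b + x" "x \<in> X" unfolding Y_def by auto
    moreover have "x \<in> span (insert b B)" using y(2) X(2) span_mono[of B "insert b B"] by blast
    ultimately show "y \<in> span (insert b B)" by (simp only:) (rule span_add[OF span_scale[OF span_base[OF insertI1]]])
  qed
  moreover have "span (insert b B) \<subseteq> closure Y"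
  proof
    fix z assume "z \<in> span (insert b B)"
    then obtain k where k: "z - k *\<^sub>R b \<in> span B" using span_breakdown_eq by blast
    show "z \<in> closure Y"
      unfolding in_closure_fun_iff
    proof (intro allI impI)
      fix A :: "'i set" and e :: real assume A: "finite A" "e > 0"
      then have e2: "e / 2 > 0" by simp
      obtain x where x: "x \<in> X" "\<forall>i\<in>A. \<bar>x i - (z - k *\<^sub>R b) i\<bar> < e / 2"
        using k X(3) A(1) e2 unfolding in_closure_fun_iff subset_iff by blast
      \<comment> \<open>\<open>C\<close> bounds all \<open>\<bar>b i\<bar>\<close> with
        \<open>i \<in> A\<close> at once, and the 1 keeps it positive.\<close>
      define C where "C = 1 + (\<Sum>i\<in>A. \<bar>b i\<bar>)"
      have C: "C > 0" unfolding C_def by (simp add: add_pos_nonneg sum_nonneg)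
      then have "k < k + e / (2 * C)" using A(2) by simp
      then obtain q where q: "k < of_rat q" "of_rat q < k + e / (2 * C)" using of_rat_dense by blast
      have "\<bar>(real_of_rat q *\<^sub>R b + x) i - z i\<bar> < e" if i: "i \<in> A" for i
      proof -
        have "\<bar>b i\<bar> \<le> (\<Sum>i\<in>A. \<bar>b i\<bar>)"
          by (rule member_le_sum[OF i _ A(1)]) simp
        then have bi: "\<bar>b i\<bar> \<le> C" by (simp add: C_def)
        have "\<bar>(of_rat q - k) * b i\<bar> = (of_rat q - k) * \<bar>b i\<bar>" using q by (simp add: abs_mult)
        also have "\<dots> \<le> (of_rat q - k) * C" using bi q(1) by (intro mult_left_mono) simp_all
        also have "\<dots> \<le> e / (2 * C) * C" using q(2) C by (intro mult_right_mono) simp_all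
        also have "\<dots> = e / 2" using C by simp
        finally have 1: "\<bar>(of_rat q - k) * b i\<bar> \<le> e / 2" .
        have 2: "\<bar>x i - (z i - k * b i)\<bar> < e / 2" using x(2) i by simp
        have "(real_of_rat q *\<^sub>R b + x) i - z i = (of_rat q - k) * b i + (x i - (z i - k * b i))"
          by (simp add: algebra_simps)
        then show ?thesis using 1 2 by linarith
      qed
      moreover have "real_of_rat q *\<^sub>R b + x \<in> Y" unfolding Y_def using x(1) by (rule_tac image_eqI[of _ _ "(q, x)"]) simp_all
      ultimately show "\<exists>y\<in>Y. \<forall>i\<in>A. \<bar>y i - z i\<bar> < e" by blast
    qed
  qed
  ultimately show ?case by blast
qed

section \<open>Linearity and continuity of row-finite matrices\<close>

lemma mat_apply_add: "mat_apply a (x + y) = mat_apply a x + mat_apply a y"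
  by (simp add: mat_apply_def fun_eq_iff pairing_add_right)

lemma mat_apply_diff: "mat_apply a (x - y) = mat_apply a x - mat_apply a y"
  by (simp add: mat_apply_def fun_eq_iff pairing_diff_right)

lemma mat_apply_scale: "mat_apply a (c *\<^sub>R x) = c *\<^sub>R mat_apply a x"
  by (simp add: mat_apply_def fun_eq_iff pairing_scale_right)

lemma row_finite_on_finite: "row_finite_on I a \<Longrightarrow> finite {j. a i j \<noteq> 0}"
  by (cases "i \<in> I") (auto simp: row_finite_on_def finitely_supported_on_def)

text \<open>Continuity at zero: finitely many outputs depend on finitely many inputs, because each
  row is finite.\<close>

lemma mat_apply_small:
  fixes a :: "'i \<Rightarrow> 'i \<Rightarrow> real"
  assumes a: "\<And>i. finite {j. a i j \<noteq> 0}" and A: "finite A" "e > 0"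
  obtains B d where "finite B" "d > 0" "\<And>z. \<forall>j\<in>B. \<bar>z j\<bar> \<le> d \<Longrightarrow> \<forall>i\<in>A. \<bar>mat_apply a z i\<bar> < e"
proof -
  let ?S = "\<lambda>i. {j. a i j \<noteq> 0}"
  \<comment> \<open>\<open>C\<close> exceeds the absolute sum of each row in \<open>A\<close> by at
    least 1, which turns the weak bound on \<open>z\<close> into a strict one on the
    outputs.\<close>
  define C where "C = 1 + (\<Sum>i\<in>A. \<Sum>j\<in>?S i. \<bar>a i j\<bar>)"
  have C: "C > 0" unfolding C_def by (simp add: add_pos_nonneg sum_nonneg)
  show thesis
  proof (rule that[of "\<Union>i\<in>A. ?S i" "e / C"])
    show "finite (\<Union>i\<in>A. ?S i)" using a A(1) by simp
    show "e / C > 0" using A(2) C by simp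
    fix z :: "'i \<Rightarrow> real" assume z: "\<forall>j\<in>(\<Union>i\<in>A. ?S i). \<bar>z j\<bar> \<le> e / C"
    show "\<forall>i\<in>A. \<bar>mat_apply a z i\<bar> < e"
    proof
      fix i assume i: "i \<in> A"
      have "\<bar>mat_apply a z i\<bar> \<le> (\<Sum>j\<in>?S i. \<bar>a i j * z j\<bar>)" unfolding mat_apply_def pairing_def by (rule sum_abs)
      also have "\<dots> \<le> (\<Sum>j\<in>?S i. \<bar>a i j\<bar> * (e / C))"
        unfolding abs_mult using i by (intro sum_mono mult_left_mono z[rule_format]) auto
      also have "\<dots> = (\<Sum>j\<in>?S i. \<bar>a i j\<bar>) * (e / C)" by (simp only: sum_distrib_right)
      also have "\<dots> \<le> (C - 1) * (e / C)"
      proof (rule mult_right_mono)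
        have "(\<Sum>j\<in>?S i. \<bar>a i j\<bar>) \<le> (\<Sum>i\<in>A. \<Sum>j\<in>?S i. \<bar>a i j\<bar>)"
          by (rule member_le_sum[OF i _ A(1)]) (simp add: sum_nonneg)
        then show "(\<Sum>j\<in>?S i. \<bar>a i j\<bar>) \<le> C - 1" by (simp add: C_def)
      qed (use A(2) C in simp)
      also have "\<dots> < C * (e / C)" using A(2) C by (intro mult_strict_right_mono) simp_all
      also have "\<dots> = e" using C by simp
      finally show "\<bar>mat_apply a z i\<bar> < e" .
    qed
  qed
qed

section \<open>Generic subspaces\<close>

text \<open>
  One shape of target serves two purposes: \<open>a\<close> a small multiple of a projection onto a closed subspace
  gives points of that subspace near \<open>y\<close>, and \<open>a\<close> the restriction to the complement of a countable
  set of coordinates gives points with prescribed values on that set. The rows of \<open>a\<close> proportional to unit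
  functions make the target too large for the span of fewer than continuum many vectors.
\<close>

definition target :: "('i \<Rightarrow> 'i \<Rightarrow> real) \<Rightarrow> ('i \<Rightarrow> real) \<Rightarrow> ('i \<Rightarrow> real) set" where
  "target a y = {y + mat_apply a v | v. \<forall>i. \<bar>v i\<bar> \<le> 1}"

definition admissible :: "'i set \<Rightarrow> ('i \<Rightarrow> 'i \<Rightarrow> real) \<Rightarrow> ('i \<Rightarrow> real) \<Rightarrow> bool" where
  "admissible I a y \<longleftrightarrow> row_finite_on I a \<and> y \<in> supported_on I \<and>
     (\<exists>c J. c \<noteq> 0 \<and> infinite J \<and> J \<subseteq> I \<and> (\<forall>j\<in>J. a j = c *\<^sub>R unit_fun j))"

definition generic_subspace :: "'i set \<Rightarrow> ('i \<Rightarrow> real) set \<Rightarrow> bool" where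
  "generic_subspace I K \<longleftrightarrow> subspace K \<and> K \<subseteq> supported_on I \<and>
     (\<forall>a y. admissible I a y \<longrightarrow> K \<inter> target a y \<noteq> {})"

section \<open>Separability of closed subspaces of a generic subspace\<close>

lemma row_finite_on_scale:
  "row_finite_on I a \<Longrightarrow> row_finite_on I (\<lambda>i. c *\<^sub>R a i)"
  by (auto simp: row_finite_on_def subspace_scale[OF subspace_finitely_supported_on])

lemma mat_apply_scale_left: "mat_apply (\<lambda>i. c *\<^sub>R a i) v = c *\<^sub>R mat_apply a v"
  by (simp add: mat_apply_def fun_eq_iff pairing_scale_left)

lemma mat_apply_supported_on: "row_finite_on I a \<Longrightarrow> mat_apply a v \<in> supported_on I"
  by (simp add: mat_apply_def supported_on_def row_finite_on_def)

text \<open>Let \<open>a\<close> project onto the closure \<open>F\<close> of \<open>S\<close>.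
  Images under \<open>a\<close> of a countable dense set are dense in \<open>F\<close>, and by
  genericity \<open>K\<close> has points of \<open>F\<close> as near to them as desired; these
  points lie in \<open>F \<inter> K = S\<close>.\<close>

lemma generic_subspace_separable:
  fixes K :: "(real \<Rightarrow> real) set"
  assumes K: "generic_subspace I K" and S: "closed_vector_subspace (subtopology euclidean K) S"
  shows "separable_space (subtopology (subtopology euclidean K) S)"
proof -
  have sS: "subspace S" using S unfolding closed_vector_subspace_def by blast
  obtain C where C: "closed C" "S = C \<inter> K"
    using S unfolding closed_vector_subspace_def closedin_subtopology closed_closedin by blast
  have SK: "S \<subseteq> K" using C(2) by blast
  have KI: "K \<subseteq> supported_on I" using K unfolding generic_subspace_def by blast
  define F where "F = closure S"
  \<comment> \<open>As \<open>S\<close> is closed in \<open>K\<close>, its closure in the whole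
    function space adds no point of \<open>K\<close>.\<close>
  have "F \<subseteq> C" unfolding F_def using C by (intro closure_minimal) auto
  then have FK: "F \<inter> K = S" using C(2) closure_subset[of S] unfolding F_def by blast
  have FI: "F \<subseteq> supported_on I"
    unfolding F_def using SK KI closed_supported_on by (intro closure_minimal) auto
  have subF: "subspace F" "closed F" unfolding F_def using closure_subspace_fun[OF sS] by auto
  obtain a J where J: "J \<subseteq> I" and a: "row_finite_on I a" and aJ: "\<And>j. j \<in> J \<Longrightarrow> a j = unit_fun j"
    "\<And>i. a i \<in> supported_on J" and aF: "\<And>x. mat_apply a x \<in> F" "\<And>x. x \<in> F \<Longrightarrow> mat_apply a x = x"
    using closed_subspace_projection[OF subF FI] by metis
  have "\<exists>X. countable X \<and> X \<subseteq> S \<and> S \<subseteq> closure X"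
  \<comment> \<open>Admissibility asks for infinitely many rows proportional to unit functions, so
    finite \<open>J\<close> is treated apart: then \<open>S\<close> lies in the span of finitely
    many columns of \<open>a\<close>.\<close>
  proof (cases "finite J")
    case True
    define col where "col j = (\<lambda>i. a i j)" for j
    have "S \<subseteq> span (col ` J)"
    proof
      fix x assume "x \<in> S"
      then have "x \<in> F" using FK by blast
      then have "x = mat_apply a x" using aF(2) by metis
      also have "\<dots> = (\<Sum>j\<in>J. x j *\<^sub>R col j)"
      proof
        fix i
        have "mat_apply a x i = (\<Sum>j\<in>J. a i j * x j)"
          unfolding mat_apply_def using aJ(2)[of i]
          by (intro pairing_eq_sum[OF True]) (simp add: supported_on_def)
        then show "mat_apply a x i = (\<Sum>j\<in>J. x j *\<^sub>R col j) i"
          by (simp add: sum_fun_apply col_def mult.commute)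
      qed
      also have "\<dots> \<in> span (col ` J)" by (intro span_sum span_scale span_base imageI)
      finally show "x \<in> span (col ` J)" .
    qed
    moreover obtain B where B: "B \<subseteq> S" "independent B" "S \<subseteq> span B"
      using maximal_independent_subset by blast
    ultimately have "finite B"
      using independent_span_bound[of "col ` J" B] True by blast
    moreover have "span B = S" using B sS span_minimal by blast
    ultimately show ?thesis using finite_span_countable_dense[of B] by simp
  next
    case False
    obtain D :: "(real \<Rightarrow> real) set" where D: "countable D" "closure D = UNIV"
      using countable_dense_real_functions by blast
    define A where "A m = (\<lambda>i. (1 / real (Suc m)) *\<^sub>R a i)" for m
    have ex: "\<exists>x. x \<in> K \<inter> target (A m) (mat_apply a d)" for d m
    proof -
      have "admissible I (A m) (mat_apply a d)"
        unfolding admissible_def A_def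
      proof (intro conjI exI ballI)
        show "row_finite_on I (\<lambda>i. (1 / real (Suc m)) *\<^sub>R a i)" by (rule row_finite_on_scale[OF a])
        show "mat_apply a d \<in> supported_on I" by (rule mat_apply_supported_on[OF a])
        show "1 / real (Suc m) \<noteq> 0" by simp
        show "infinite J" "J \<subseteq> I" by fact+
        show "(1 / real (Suc m)) *\<^sub>R a j = (1 / real (Suc m)) *\<^sub>R unit_fun j" if "j \<in> J" for j
          using aJ(1)[OF that] by simp
      qed
      then show ?thesis using K unfolding generic_subspace_def by blast
    qed
    define X where "X d m = (SOME x. x \<in> K \<inter> target (A m) (mat_apply a d))" for d m
    have X: "X d m \<in> K \<inter> target (A m) (mat_apply a d)" for d m
      unfolding X_def by (rule someI_ex[OF ex])
    \<comment> \<open>Each chosen point is \<open>a\<close> applied to a point within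
      \<open>1 / Suc m\<close> of \<open>d\<close> in every coordinate. In particular it lies in the
      range of \<open>a\<close>, that is in \<open>F\<close>.\<close>
    have "\<exists>v. X d m = mat_apply a (d + (1 / real (Suc m)) *\<^sub>R v) \<and> (\<forall>i. \<bar>v i\<bar> \<le> 1)" for d m
    proof -
      obtain v where v: "X d m = mat_apply a d + mat_apply (A m) v" "\<forall>i. \<bar>v i\<bar> \<le> 1"
        using X[of d m] unfolding target_def by blast
      then have "X d m = mat_apply a (d + (1 / real (Suc m)) *\<^sub>R v)"
        unfolding A_def by (simp only: mat_apply_scale_left mat_apply_add mat_apply_scale)
      then show ?thesis using v(2) by blast
    qed
    then obtain V where V: "\<And>d m. X d m = mat_apply a (d + (1 / real (Suc m)) *\<^sub>R V d m)"
      "\<And>d m i. \<bar>V d m i\<bar> \<le> 1" by metis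
    define Y where "Y = (\<lambda>(d, m). X d m) ` (D \<times> UNIV)"
    have "countable Y" unfolding Y_def using D(1) by simp
    moreover have "X d m \<in> S" for d m
      using X[of d m] aF(1) V(1)[of d m] FK by auto
    then have "Y \<subseteq> S" unfolding Y_def by auto
    moreover have "S \<subseteq> closure Y"
    proof
      fix x assume "x \<in> S"
      then have x: "mat_apply a x = x" using FK aF(2) by blast
      show "x \<in> closure Y"
        unfolding in_closure_fun_iff
      proof (intro allI impI)
        fix T :: "real set" and e :: real assume T: "finite T" "e > 0"
        obtain B \<delta> where B: "finite B" "\<delta> > 0"
          "\<And>z. \<forall>j\<in>B. \<bar>z j\<bar> \<le> \<delta> \<Longrightarrow> \<forall>i\<in>T. \<bar>mat_apply a z i\<bar> < e"
          using mat_apply_small[of a, OF row_finite_on_finite[OF a] T] by metis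
        have "x \<in> closure D" using D(2) by simp
        moreover have "\<delta> / 2 > 0" using B(2) by simp
        ultimately obtain d where d: "d \<in> D" "\<forall>j\<in>B. \<bar>d j - x j\<bar> < \<delta> / 2"
          using B(1) unfolding in_closure_fun_iff by blast
        obtain m where m: "inverse (real (Suc m)) < \<delta> / 2"
          using reals_Archimedean[of "\<delta> / 2"] B(2) by auto
        \<comment> \<open>The error \<open>X d m - x\<close> equals \<open>mat_apply a z\<close>. On
          \<open>B\<close>, both the distance from \<open>d\<close> to \<open>x\<close> and the
          perturbation contribute less than \<open>\<delta> / 2\<close> to \<open>z\<close>.\<close>
        define z where "z = d + (1 / real (Suc m)) *\<^sub>R V d m - x"
        have "\<bar>z j\<bar> \<le> \<delta>" if "j \<in> B" for j
        proof -
          have "\<bar>(1 / real (Suc m)) * V d m j\<bar> \<le> 1 / real (Suc m)"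
            using mult_left_mono[OF V(2)[of d m j], of "1 / real (Suc m)"] by (simp add: abs_mult)
          also have "\<dots> < \<delta> / 2" using m by (simp add: inverse_eq_divide)
          finally have 1: "\<bar>(1 / real (Suc m)) * V d m j\<bar> < \<delta> / 2" .
          have 2: "\<bar>d j - x j\<bar> < \<delta> / 2" using d(2) that by blast
          have "z j = (1 / real (Suc m)) * V d m j + (d j - x j)" by (simp add: z_def)
          then show ?thesis using 1 2 by linarith
        qed
        then have *: "\<forall>i\<in>T. \<bar>mat_apply a z i\<bar> < e" using B(3) by blast
        have "mat_apply a z = X d m - x"
          unfolding z_def mat_apply_diff V(1)[symmetric] x ..
        then have "\<forall>i\<in>T. \<bar>X d m i - x i\<bar> < e" using * by simp
        moreover have "X d m \<in> Y" unfolding Y_def using d(1) by force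
        ultimately show "\<exists>y\<in>Y. \<forall>i\<in>T. \<bar>y i - x i\<bar> < e" by blast
      qed
    qed
    ultimately show ?thesis by blast
  qed
  then obtain X where "countable X" "X \<subseteq> S" "S \<subseteq> closure X" by blast
  then have "separable_space (subtopology euclidean S)" by (rule separable_subtopology_fun)
  then show ?thesis using SK by (simp add: subtopology_subtopology Int_absorb1)
qed

text \<open>The matrix erases the coordinates in \<open>A\<close> and keeps the others in
  \<open>I\<close>, so all points of the target agree with \<open>z\<close> on \<open>A\<close>.
  Uncountability of \<open>I\<close> leaves the infinitely many coordinates that admissibility
  requires.\<close>

lemma generic_subspace_prescribe:
  assumes K: "generic_subspace I K" and I: "uncountable I" and A: "countable A" "A \<subseteq> I"
  obtains x where "x \<in> K" "\<And>i. i \<in> A \<Longrightarrow> x i = z i"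
proof -
  define a where "a i = (if i \<in> I - A then unit_fun i else 0)" for i
  define y where "y i = (if i \<in> A then z i else 0)" for i
  have "infinite (I - A)" using I A(1) by (metis countable_finite uncountable_minus_countable)
  have "admissible I a y"
    unfolding admissible_def
  proof (intro conjI exI ballI)
    show "row_finite_on I a"
      by (auto simp: row_finite_on_def a_def finitely_supported_on_eq_span span_base span_zero)
    show "y \<in> supported_on I" using A(2) by (auto simp: y_def supported_on_def)
    show "infinite (I - A)" by fact
    show "a j = 1 *\<^sub>R unit_fun j" if "j \<in> I - A" for j using that by (simp add: a_def)
  qed auto
  then obtain x where x: "x \<in> K" "x \<in> target a y" using K unfolding generic_subspace_def by blast
  then obtain v where v: "x = y + mat_apply a v" unfolding target_def by blast
  have "x i = z i" if "i \<in> A" for i using that by (simp add: v y_def mat_apply_def a_def)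
  with x(1) show thesis by (rule that)
qed

section \<open>Boxes and pseudocompleteness\<close>

definition coordinate_box :: "'i set \<Rightarrow> ('i \<Rightarrow> real) \<Rightarrow> ('i \<Rightarrow> real) \<Rightarrow> ('i \<Rightarrow> real) set" where
  "coordinate_box A l u = {x. \<forall>i\<in>A. l i < x i \<and> x i < u i}"

text \<open>One \<pi>-base of boxes serves at every stage. The closure condition makes the boxes
  shrink strictly in each constrained coordinate, so each has a common value; only countably many
  coordinates are constrained, and \<open>K\<close> has a point with these values.\<close>

lemma generic_subspace_pseudocomplete:
  fixes K :: "('i \<Rightarrow> real) set"
  assumes K: "generic_subspace I K" and I: "uncountable I"
  shows "pseudocomplete (subtopology euclidean K)"
proof -
  let ?T = "subtopology euclidean K"
  define P where "P = {K \<inter> coordinate_box A l u | A l u. finite A \<and> A \<subseteq> I \<and> (\<forall>i\<in>A. l i < u i)}"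
  have KI: "K \<subseteq> supported_on I" using K unfolding generic_subspace_def by blast
  have base: "pi_base ?T P"
    unfolding pi_base_def
  proof (intro conjI ballI allI impI)
    fix U assume "U \<in> P"
    then obtain A l u where U: "U = K \<inter> coordinate_box A l u" "finite A" "A \<subseteq> I" "\<forall>i\<in>A. l i < u i"
      unfolding P_def by blast
    have "open (coordinate_box A l u)" unfolding coordinate_box_def by (rule open_box[OF U(2)])
    then show "openin ?T U" unfolding U(1) by (rule openin_open_Int)
    \<comment> \<open>Midpoints can be prescribed within \<open>K\<close>, so no box misses
      \<open>K\<close>.\<close>
    obtain x where x: "x \<in> K" "\<And>i. i \<in> A \<Longrightarrow> x i = (l i + u i) / 2"
      using generic_subspace_prescribe[OF K I countable_finite[OF U(2)] U(3), of "\<lambda>i. (l i + u i) / 2"] by blast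
    have "l i < x i \<and> x i < u i" if "i \<in> A" for i
      using x(2)[OF that] bspec[OF U(4) that] by simp
    then have "x \<in> coordinate_box A l u" unfolding coordinate_box_def by blast
    then show "U \<noteq> {}" using x(1) U(1) by blast
  next
    fix V assume V: "openin ?T V \<and> V \<noteq> {}"
    then obtain W where W: "open W" "V = K \<inter> W" unfolding openin_open by blast
    obtain x where x: "x \<in> K" "x \<in> W" using V W(2) by blast
    obtain A e where A: "finite A" "e > 0" "\<And>y. \<forall>i\<in>A. \<bar>y i - x i\<bar> < e \<Longrightarrow> y \<in> W"
      using open_fun_contains_box[OF W(1) x(2)] by metis
    let ?B = "K \<inter> coordinate_box (A \<inter> I) (\<lambda>i. x i - e) (\<lambda>i. x i + e)"
    have "?B \<subseteq> V"
    proof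
      fix y assume y: "y \<in> ?B"
      have "\<bar>y i - x i\<bar> < e" if "i \<in> A" for i
      proof (cases "i \<in> I")
        case True
        then have "x i - e < y i \<and> y i < x i + e" using y that unfolding coordinate_box_def by blast
        then show ?thesis by linarith
      next
        case False
        then have "y i = 0" "x i = 0" using KI x(1) y unfolding supported_on_def by blast+
        then show ?thesis using A(2) by simp
      qed
      then have "y \<in> W" using A(3) by blast
      then show "y \<in> V" using y W(2) by blast
    qed
    moreover have "?B \<in> P"
      unfolding P_def using A(1,2) by (intro CollectI exI[of _ "A \<inter> I"] exI[of _ "\<lambda>i. x i - e"] exI[of _ "\<lambda>i. x i + e"]) auto
    ultimately show "\<exists>U\<in>P. U \<subseteq> V" by blast
  qed
  have "(\<Inter>n. U n) \<noteq> {}" if U: "\<forall>n. U n \<in> P \<and> ?T closure_of U (Suc n) \<subseteq> U n" for U :: "nat \<Rightarrow> ('i \<Rightarrow> real) set"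
  proof -
    have "\<forall>n. \<exists>A l u. U n = K \<inter> coordinate_box A l u \<and> finite A \<and> A \<subseteq> I \<and> (\<forall>i\<in>A. l i < u i)"
      using U unfolding P_def by blast
    then obtain A l u where Un: "\<And>n. U n = K \<inter> coordinate_box (A n) (l n) (u n)" "\<And>n. finite (A n)"
      "\<And>n. A n \<subseteq> I" "\<And>n i. i \<in> A n \<Longrightarrow> l n i < u n i" by metis
    \<comment> \<open>If \<open>t\<close> lies in the closed side of the next box at
      \<open>i\<close>, or the next box leaves \<open>i\<close> free, then the closure of that box
      has a point of \<open>K\<close> with value \<open>t\<close> at \<open>i\<close>; hence
      \<open>t\<close> lies in the open side of the present box.\<close>
    have step: "l n i < t \<and> t < u n i"
      if i: "i \<in> A n" and t: "i \<in> A (Suc n) \<Longrightarrow> l (Suc n) i \<le> t \<and> t \<le> u (Suc n) i" for n i t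
    proof -
      let ?A = "A (Suc n)" and ?l = "l (Suc n)" and ?u = "u (Suc n)"
      have prescribe: "\<exists>x\<in>K. \<forall>k\<in>B. x k = z k" if "finite B" "B \<subseteq> I" for B z
        using generic_subspace_prescribe[OF K I countable_finite[OF that(1)] that(2)] by metis
      have fin: "finite (insert i ?A)" "insert i ?A \<subseteq> I" using Un(2,3) i by blast+
      \<comment> \<open>The constrained coordinates other than \<open>i\<close> sit at midpoints, so
        among these sides only that of \<open>i\<close> may be met at an endpoint.\<close>
      define z where "z = (\<lambda>k. if k = i then t else (?l k + ?u k) / 2)"
      obtain x where x: "x \<in> K" "\<forall>k\<in>insert i ?A. x k = z k"
        using prescribe[OF fin] by blast
      have "x \<in> closure (U (Suc n))"
        unfolding in_closure_fun_iff
      proof (intro allI impI)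
        fix B :: "'i set" and e :: real assume B: "finite B" "e > 0"
        have "\<exists>s. \<bar>s - t\<bar> < e \<and> (i \<in> ?A \<longrightarrow> ?l i < s \<and> s < ?u i)"
        proof (cases "i \<in> ?A")
          case True
          then have lu: "?l i < ?u i" "?l i \<le> t" "t \<le> ?u i" using t Un(4) by blast+
          then have "max (?l i) (t - e) < min (?u i) (t + e)" using B(2) by auto
          then obtain s where "max (?l i) (t - e) < s" "s < min (?u i) (t + e)" using dense by blast
          then show ?thesis by (intro exI[of _ s]) auto
        qed (use B(2) in \<open>auto intro!: exI[of _ t]\<close>)
        then obtain s where s: "\<bar>s - t\<bar> < e" "i \<in> ?A \<Longrightarrow> ?l i < s \<and> s < ?u i" by blast
        have fin2: "finite (insert i ?A \<union> (B \<inter> I))" "insert i ?A \<union> (B \<inter> I) \<subseteq> I" using fin B(1) by blast+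
        obtain y where y: "y \<in> K" "\<forall>k\<in>insert i ?A \<union> (B \<inter> I). y k = (if k = i then s else x k)"
          using prescribe[OF fin2, of "\<lambda>k. if k = i then s else x k"] by blast
        have "y \<in> coordinate_box ?A ?l ?u"
          unfolding coordinate_box_def
        proof (intro CollectI ballI)
          fix k assume k: "k \<in> ?A"
          show "?l k < y k \<and> y k < ?u k"
          proof (cases "k = i")
            case True
            then show ?thesis using k s(2) y(2) by simp
          next
            case False
            then have "y k = (?l k + ?u k) / 2" using k x(2) y(2) by (simp add: z_def)
            then show ?thesis using Un(4)[OF k] by simp
          qed
        qed
        then have "y \<in> U (Suc n)" using y(1) Un(1) by blast
        moreover have "\<bar>y k - x k\<bar> < e" if k: "k \<in> B" for k
        proof (cases "k \<in> I")
          case True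
          then have "y k = (if k = i then s else x k)" using k y(2) by blast
          moreover have "x i = t" using x(2) by (simp add: z_def)
          ultimately show ?thesis using s(1) B(2) by (cases "k = i") auto
        next
          case False
          then have "y k = 0" "x k = 0" using KI x(1) y(1) unfolding supported_on_def by blast+
          then show ?thesis using B(2) by simp
        qed
        ultimately show "\<exists>y\<in>U (Suc n). \<forall>k\<in>B. \<bar>y k - x k\<bar> < e" by blast
      qed
      moreover have "?T closure_of U (Suc n) = K \<inter> closure (U (Suc n))"
        using Un(1)[of "Suc n"] by (simp add: closure_of_subtopology Int_absorb1)
      ultimately have "x \<in> U n" using x(1) U by blast
      then have "l n i < x i \<and> x i < u n i" using i Un(1)[of n] unfolding coordinate_box_def by blast
      then show ?thesis using x(2) by (simp add: z_def)
    qed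
    \<comment> \<open>If the next box left \<open>i\<close> free, even the excluded endpoint
      \<open>u n i\<close> would be an allowed value.\<close>
    have A_mono: "A n \<subseteq> A (Suc n)" for n
    proof
      fix i assume i: "i \<in> A n"
      show "i \<in> A (Suc n)"
      proof (rule ccontr)
        assume "i \<notin> A (Suc n)"
        then show False using step[OF i, of "u n i"] by simp
      qed
    qed
    \<comment> \<open>Both endpoints of the next side are themselves allowed values of
      \<open>t\<close>.\<close>
    have nest: "l n i < l (Suc n) i \<and> u (Suc n) i < u n i" if "i \<in> A n" for i n
    proof -
      have "i \<in> A (Suc n)" using that A_mono by blast
      then have "l (Suc n) i \<le> u (Suc n) i" using Un(4) less_imp_le by blast
      then show ?thesis using step[OF that, of "l (Suc n) i"] step[OF that, of "u (Suc n) i"] by simp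
    qed
    have nest_le: "i \<in> A m \<and> l n i \<le> l m i \<and> u m i \<le> u n i" if "n \<le> m" "i \<in> A n" for n m i
      using that
    proof (induction m rule: dec_induct)
      case (step m)
      then show ?case using nest[of i m] A_mono[of m] by force
    qed simp
    have "\<exists>p. \<forall>n. i \<in> A n \<longrightarrow> l n i < p \<and> p < u n i" for i
    proof (cases "\<exists>n. i \<in> A n")
      case True
      then obtain n0 where n0: "i \<in> A n0" by blast
      have lu: "l n i \<le> u m i" if "i \<in> A n" "i \<in> A m" for n m
      proof -
        have "l n i \<le> l (max n m) i" "u (max n m) i \<le> u m i" "i \<in> A (max n m)"
          using nest_le[of n "max n m" i] nest_le[of m "max n m" i] that by auto
        then show ?thesis using Un(4)[of i "max n m"] by linarith
      qed
      \<comment> \<open>The supremum of the lower endpoints lies in every closed side, and strict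
        nesting then puts it into every open one.\<close>
      define p where "p = (SUP n\<in>{n. i \<in> A n}. l n i)"
      have bdd: "bdd_above ((\<lambda>n. l n i) ` {n. i \<in> A n})"
        using lu[OF _ n0] by (intro bdd_aboveI2[of _ _ "u n0 i"]) simp
      have "l n i < p \<and> p < u n i" if i: "i \<in> A n" for n
      proof -
        have iS: "i \<in> A (Suc n)" using i A_mono by blast
        have "l (Suc n) i \<le> p" unfolding p_def by (rule cSUP_upper[OF _ bdd]) (simp add: iS)
        moreover have "p \<le> u (Suc n) i" unfolding p_def using n0 lu[OF _ iS] by (intro cSUP_least) auto
        ultimately show ?thesis using nest[OF i] by linarith
      qed
      then show ?thesis by blast
    qed blast
    then obtain p where p: "\<And>i n. i \<in> A n \<Longrightarrow> l n i < p i \<and> p i < u n i" by metis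
    have "countable (\<Union>n. A n)" by (rule countable_UN) (simp_all add: countable_finite[OF Un(2)])
    moreover have "(\<Union>n. A n) \<subseteq> I" using Un(3) by blast
    ultimately obtain x where x: "x \<in> K" "\<And>i. i \<in> (\<Union>n. A n) \<Longrightarrow> x i = p i"
      using generic_subspace_prescribe[OF K I] by metis
    have "x \<in> U n" for n
    proof -
      have "l n i < x i \<and> x i < u n i" if "i \<in> A n" for i
      proof -
        have "x i = p i" using that by (intro x(2)) blast
        then show ?thesis using p[OF that] by simp
      qed
      then show ?thesis unfolding Un(1) coordinate_box_def using x(1) by blast
    qed
    then show ?thesis by blast
  qed
  then show ?thesis
    unfolding pseudocomplete_def using base by (intro exI[of _ "\<lambda>_. P"]) blast
qed

section \<open>Independent choices of length continuum\<close>

text \<open>Evaluating a linear relation at all \<open>j k\<close> gives the same relation for the values of any polynomial.\<close>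

lemma geometric_family_independent:
  fixes w :: "real \<Rightarrow> 'i \<Rightarrow> real" and j :: "nat \<Rightarrow> 'i"
  assumes w: "\<And>\<theta> k. \<theta> \<in> T \<Longrightarrow> w \<theta> (j k) = c * \<theta> ^ k" and c: "c \<noteq> 0"
  shows "inj_on w T" "independent (w ` T)"
proof -
  show inj: "inj_on w T"
  proof (rule inj_onI)
    fix s t assume st: "s \<in> T" "t \<in> T" "w s = w t"
    then have "c * s ^ 1 = c * t ^ 1" using w by metis
    then show "s = t" using c by simp
  qed
  show "independent (w ` T)"
    unfolding real_vector.independent_explicit_finite_subsets
  proof (intro allI impI ballI)
    fix S u v assume S: "S \<subseteq> w ` T" "finite S" "(\<Sum>v\<in>S. u v *\<^sub>R v) = 0" "v \<in> S"
    define R where "R = {\<theta> \<in> T. w \<theta> \<in> S}"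
    have R: "S = w ` R" "inj_on w R" "R \<subseteq> T" using S(1) inj unfolding R_def inj_on_def by auto
    then have finR: "finite R" using S(2) finite_imageD by blast
    obtain \<theta>0 where t0: "\<theta>0 \<in> R" "v = w \<theta>0" using S(4) R(1) by blast
    have pow: "(\<Sum>\<theta>\<in>R. u (w \<theta>) * \<theta> ^ k) = 0" for k
    proof -
      have "0 = (\<Sum>\<theta>\<in>R. u (w \<theta>) *\<^sub>R w \<theta>) (j k)"
        using S(3) unfolding R(1) sum.reindex[OF R(2)] by simp
      also have "\<dots> = (\<Sum>\<theta>\<in>R. u (w \<theta>) * (c * \<theta> ^ k))"
        using R(3) w by (auto simp: sum_fun_apply intro!: sum.cong)
      also have "\<dots> = c * (\<Sum>\<theta>\<in>R. u (w \<theta>) * \<theta> ^ k)" by (simp add: sum_distrib_left mult_ac)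
      finally show ?thesis using c by simp
    qed
    have poly: "(\<Sum>\<theta>\<in>R. u (w \<theta>) * poly p \<theta>) = 0" for p
    proof -
      have "(\<Sum>\<theta>\<in>R. u (w \<theta>) * poly p \<theta>) = (\<Sum>k\<le>degree p. coeff p k * (\<Sum>\<theta>\<in>R. u (w \<theta>) * \<theta> ^ k))"
        unfolding poly_altdef sum_distrib_left by (subst sum.swap) (simp add: mult_ac)
      then show ?thesis by (simp add: pow)
    qed
    \<comment> \<open>This polynomial vanishes at all parameters in \<open>R\<close> but
      \<open>\<theta>0\<close>, which isolates the coefficient of \<open>v\<close>.\<close>
    define p where "p = (\<Prod>t\<in>R - {\<theta>0}. [:- t, 1:])"
    have "poly p \<theta> = 0" if "\<theta> \<in> R - {\<theta>0}" for \<theta>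
      unfolding p_def poly_prod using finR that by (auto intro!: prod_zero bexI[of _ \<theta>])
    then have "(\<Sum>\<theta>\<in>R. u (w \<theta>) * poly p \<theta>) = u (w \<theta>0) * poly p \<theta>0"
      using sum.remove[OF finR t0(1), of "\<lambda>\<theta>. u (w \<theta>) * poly p \<theta>"] by simp
    moreover have "poly p \<theta>0 \<noteq> 0"
      unfolding p_def poly_prod using finR by simp
    ultimately show "u v = 0" using poly[of p] t0(2) by simp
  qed
qed

section \<open>Size of independent sets in a span\<close>

lemma card_of_lists_ordLeq:
  assumes "infinite Z"
  shows "|lists Z| \<le>o |Z|"
proof -
  \<comment> \<open>Grading by length makes this a countable union; each level stays below
    \<open>Z\<close> because \<open>Z\<close> absorbs products with sets no larger than
    itself.\<close>
  define L where "L n = {xs \<in> lists Z. length xs = n}" for n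
  have "|L n| \<le>o |Z|" for n
  proof (induction n)
    case 0
    have "L 0 = {[]}" by (auto simp: L_def)
    then show ?case using assms by (simp add: card_of_singl_ordLeq infinite_imp_nonempty)
  next
    case (Suc n)
    have "L (Suc n) = (\<lambda>(x, xs). x # xs) ` (Z \<times> L n)"
      by (auto simp: L_def image_iff length_Suc_conv)
    then have "|L (Suc n)| \<le>o |Z \<times> L n|" by (simp add: card_of_image)
    also have "|Z \<times> L n| \<le>o |Z|"
      using Suc assms by (intro card_of_Sigma_ordLeq_infinite) (auto simp: card_of_refl ordIso_imp_ordLeq)
    finally show ?case .
  qed
  then have "|\<Union>n. L n| \<le>o |Z|"
    using assms by (intro card_of_UNION_ordLeq_infinite) (auto simp: infinite_iff_card_of_nat)
  moreover have "(\<Union>n. L n) = lists Z" by (auto simp: L_def)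
  ultimately show ?thesis by simp
qed

text \<open>Each element of \<open>B\<close> lies in the span of a finite list from
  \<open>Z\<close>, and each such span holds only finitely many elements of
  \<open>B\<close>.\<close>

lemma card_of_independent_ordLeq:
  fixes B Z :: "'v::real_vector set"
  assumes Z: "infinite Z" and B: "independent B" "B \<subseteq> span Z"
  shows "|B| \<le>o |Z|"
proof -
  have "B \<subseteq> (\<Union>xs\<in>lists Z. B \<inter> span (set xs))"
  proof
    fix b assume b: "b \<in> B"
    then obtain t u where t: "finite t" "t \<subseteq> Z" "b = (\<Sum>a\<in>t. u a *\<^sub>R a)"
      using B(2) unfolding real_vector.span_explicit by auto
    obtain xs where xs: "set xs = t" using finite_list[OF t(1)] by blast
    have "b \<in> span (set xs)" unfolding xs t(3) by (intro span_sum span_scale span_base)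
    moreover have "xs \<in> lists Z" using xs t(2) by auto
    ultimately show "b \<in> (\<Union>xs\<in>lists Z. B \<inter> span (set xs))" using b by blast
  qed
  then have "|B| \<le>o |\<Union>xs\<in>lists Z. B \<inter> span (set xs)|" by (rule card_of_mono1)
  also have "|\<Union>xs\<in>lists Z. B \<inter> span (set xs)| \<le>o |Z|"
  proof (rule card_of_UNION_ordLeq_infinite[OF Z card_of_lists_ordLeq[OF Z]], rule ballI)
    fix xs assume "xs \<in> lists Z"
    have "independent (B \<inter> span (set xs))" using B(1) independent_mono by blast
    then have "finite (B \<inter> span (set xs))"
      using independent_span_bound[of "set xs" "B \<inter> span (set xs)"] by blast
    then show "|B \<inter> span (set xs)| \<le>o |Z|"
      using Z by (intro ordLess_imp_ordLeq finite_ordLess_infinite) (simp_all add: card_of_well_order_on Field_card_of)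
  qed
  finally show ?thesis .
qed

text \<open>Placing the powers of \<open>\<theta>\<close> along a sequence in \<open>J\<close> gives
  continuum many vectors whose images under \<open>a\<close> are independent, and all of them would
  lie in \<open>span Z\<close>.\<close>

lemma admissible_target_not_subset_span:
  fixes y :: "'i \<Rightarrow> real"
  assumes ay: "admissible I a y" and Z: "|Z| <o |UNIV :: real set|"
  shows "\<not> target a y \<subseteq> span Z"
proof
  assume sub: "target a y \<subseteq> span Z"
  obtain c J where c: "c \<noteq> 0" "infinite J" "J \<subseteq> I" "\<forall>j\<in>J. a j = c *\<^sub>R unit_fun j"
    using ay unfolding admissible_def by blast
  obtain j :: "nat \<Rightarrow> 'i" where j: "inj j" "range j \<subseteq> J" using infinite_countable_subset[OF c(2)] by blast
  define v where "v \<theta> = (\<lambda>i. if i \<in> range j then \<theta> ^ (inv j i) else 0)" for \<theta> :: real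
  define w where "w \<theta> = mat_apply a (v \<theta>)" for \<theta>
  \<comment> \<open>For these \<open>\<theta>\<close> all powers are at most 1, as the target
    requires, and there are still continuum many of them.\<close>
  let ?T = "{0<..<1::real}"
  have wj: "w \<theta> (j k) = c * \<theta> ^ k" for \<theta> k
  proof -
    have "a (j k) = c *\<^sub>R unit_fun (j k)" using c(4) j(2) by blast
    then show ?thesis by (simp add: w_def mat_apply_def pairing_scale_left v_def j(1))
  qed
  \<comment> \<open>The choice \<open>v = 0\<close> puts \<open>y\<close> itself into the target, so
    \<open>y\<close> can be subtracted from its other points.\<close>
  have y: "y \<in> span Z"
  proof -
    have "y + mat_apply a 0 \<in> target a y" unfolding target_def by (intro CollectI exI[of _ 0]) simp
    moreover have "mat_apply a 0 = 0" by (simp add: mat_apply_def fun_eq_iff)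
    ultimately show ?thesis using sub by auto
  qed
  have w_span: "w \<theta> \<in> span Z" if "\<theta> \<in> ?T" for \<theta>
  proof -
    have "\<bar>v \<theta> i\<bar> \<le> 1" for i using that by (simp add: v_def power_le_one)
    then have "y + w \<theta> \<in> span Z" using sub unfolding target_def w_def by blast
    then have "y + w \<theta> - y \<in> span Z" using y by (rule span_diff)
    then show ?thesis by simp
  qed
  have ind: "independent (w ` ?T)" "inj_on w ?T"
    using geometric_family_independent[of ?T w j c] wj c(1) by blast+
  have inf: "infinite (w ` ?T)" using ind(2) by (simp add: finite_image_iff)
  have sub': "w ` ?T \<subseteq> span Z" using w_span by blast
  then have "infinite Z" using independent_span_bound[OF _ ind(1)] inf by blast
  then have "|w ` ?T| \<le>o |Z|" using card_of_independent_ordLeq ind(1) sub' by blast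
  moreover have "|?T| =o |w ` ?T|"
    using ind(2) by (intro card_of_ordIsoI[of w]) (simp add: bij_betw_def)
  moreover have "|UNIV :: real set| \<le>o |?T|"
  proof -
    \<comment> \<open>A rescaled arctangent embeds the reals into the open unit interval.\<close>
    have "inj (\<lambda>x::real. arctan x / pi + 1 / 2)" by (auto intro!: injI simp: arctan_eq_iff)
    moreover have "arctan x / pi + 1 / 2 \<in> ?T" for x
      using arctan_bounded[of x] pi_gt_zero by (simp add: field_simps)
    ultimately show ?thesis by (intro card_of_ordLeqI[of "\<lambda>x::real. arctan x / pi + 1 / 2"]) auto
  qed
  ultimately have "|UNIV :: real set| \<le>o |Z|"
    by (metis ordLeq_ordIso_trans ordLeq_transitive)
  then show False using Z not_ordLess_ordLeq by blast
qed

section \<open>Transfinite choice of independent vectors\<close>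

lemma finite_linear_order_max:
  assumes "linear_order_on UNIV r" "finite D" "D \<noteq> {}"
  shows "\<exists>m\<in>D. \<forall>x\<in>D. (x, m) \<in> r"
  using assms(2,3)
proof (induction D rule: finite_ne_induct)
  case (singleton x)
  show ?case using assms(1) by (simp add: order_on_defs refl_on_def)
next
  case (insert x D)
  then obtain m where m: "m \<in> D" "\<forall>x\<in>D. (x, m) \<in> r" by blast
  have r: "refl r" "trans r" "total r" using assms(1) by (auto simp: order_on_defs)
  show ?case
  proof (cases "(x, m) \<in> r")
    case True
    then show ?thesis using m by blast
  next
    case False
    then have "(m, x) \<in> r" using r by (metis UNIV_I refl_onD total_on_def)
    then have "\<forall>z\<in>insert x D. (z, x) \<in> r" using m(2) r by (metis UNIV_I insertE refl_onD transD)
    then show ?thesis by blast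
  qed
qed

text \<open>The combination is indexed by elements of \<open>A\<close> rather than by vectors; as
  \<open>f\<close> need not be injective, \<open>g\<close> picks one index for each vector.\<close>

lemma span_image_sum:
  assumes "x \<in> span (f ` A)"
  obtains T c where "finite T" "T \<subseteq> A" "x = (\<Sum>i\<in>T. c i *\<^sub>R f i)"
proof -
  obtain t u where t: "finite t" "t \<subseteq> f ` A" "x = (\<Sum>a\<in>t. u a *\<^sub>R a)"
    using assms unfolding real_vector.span_explicit by auto
  obtain g where g: "\<And>a. a \<in> t \<Longrightarrow> g a \<in> A \<and> f (g a) = a" using t(2) by (metis image_iff subset_iff)
  have inj: "inj_on g t" using g by (metis inj_onI)
  show thesis
  proof (rule that[of "g ` t" "\<lambda>i. u (f i)"])
    show "x = (\<Sum>i\<in>g ` t. u (f i) *\<^sub>R f i)"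
      unfolding sum.reindex[OF inj] t(3) using g by (intro sum.cong) auto
  qed (use t g in auto)
qed

text \<open>In a relation modulo \<open>span E\<close>, the largest index with nonzero coefficient
  would put its vector into the span of \<open>E\<close> and the earlier vectors. So the family is
  independent modulo \<open>span E\<close>.\<close>

lemma span_Int_of_transfinite_independent:
  fixes f :: "'k \<Rightarrow> 'v::real_vector"
  assumes r: "linear_order_on UNIV r" and f: "\<And>i. f i \<notin> span (E \<union> f ` underS r i)"
    and AB: "A \<inter> B = {}"
  shows "span (E \<union> f ` A) \<inter> span (E \<union> f ` B) = span E"
proof
  have zero: "d i = 0" if U: "finite U" "(\<Sum>i\<in>U. d i *\<^sub>R f i) \<in> span E" "i \<in> U" for U d i
  proof (rule ccontr)
    let ?D = "{i \<in> U. d i \<noteq> 0}"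
    assume "d i \<noteq> 0"
    then have "?D \<noteq> {}" using U(3) by blast
    moreover have "finite ?D" using U(1) by simp
    ultimately obtain m where m: "m \<in> ?D" "\<forall>x\<in>?D. (x, m) \<in> r"
      using finite_linear_order_max[OF r, of ?D] by blast
    let ?S = "span (E \<union> f ` underS r m)"
    have "(\<Sum>i\<in>U. d i *\<^sub>R f i) = d m *\<^sub>R f m + (\<Sum>i\<in>U - {m}. d i *\<^sub>R f i)"
      using U(1) m(1) by (intro sum.remove) auto
    then have "d m *\<^sub>R f m = (\<Sum>i\<in>U. d i *\<^sub>R f i) - (\<Sum>i\<in>U - {m}. d i *\<^sub>R f i)" by simp
    also have "\<dots> \<in> ?S"
    proof (rule span_diff)
      show "(\<Sum>i\<in>U. d i *\<^sub>R f i) \<in> ?S" using U(2) span_mono[of E "E \<union> f ` underS r m"] by blast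
      show "(\<Sum>i\<in>U - {m}. d i *\<^sub>R f i) \<in> ?S"
      proof (rule span_sum)
        fix i assume i: "i \<in> U - {m}"
        show "d i *\<^sub>R f i \<in> ?S"
        proof (cases "d i = 0")
          case False
          then have "i \<in> underS r m" using i m(2) unfolding underS_def by blast
          then show ?thesis by (intro span_scale span_base) blast
        qed (simp add: span_zero)
      qed
    qed
    finally have "(1 / d m) *\<^sub>R (d m *\<^sub>R f m) \<in> ?S" by (rule span_scale)
    then show False using m(1) f[of m] by simp
  qed
  show "span (E \<union> f ` A) \<inter> span (E \<union> f ` B) \<subseteq> span E"
  proof
    fix x assume "x \<in> span (E \<union> f ` A) \<inter> span (E \<union> f ` B)"
    then obtain e1 x1 e2 x2 where x: "x = e1 + x1" "e1 \<in> span E" "x1 \<in> span (f ` A)"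
      "x = e2 + x2" "e2 \<in> span E" "x2 \<in> span (f ` B)"
      unfolding span_Un by blast
    obtain T c where T: "finite T" "T \<subseteq> A" "x1 = (\<Sum>i\<in>T. c i *\<^sub>R f i)" using span_image_sum[OF x(3)] by metis
    obtain T' c' where T': "finite T'" "T' \<subseteq> B" "x2 = (\<Sum>i\<in>T'. c' i *\<^sub>R f i)" using span_image_sum[OF x(6)] by metis
    \<comment> \<open>These are the coefficients of the difference of the two representations of
      \<open>x\<close>, with \<open>T\<close> and \<open>T'\<close> disjoint.\<close>
    define d where "d i = (if i \<in> T then c i else - c' i)" for i
    have disj: "T \<inter> T' = {}" using T(2) T'(2) AB by blast
    have "(\<Sum>i\<in>T \<union> T'. d i *\<^sub>R f i) = (\<Sum>i\<in>T. d i *\<^sub>R f i) + (\<Sum>i\<in>T'. d i *\<^sub>R f i)"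
      using T(1) T'(1) disj by (rule sum.union_disjoint)
    also have "(\<Sum>i\<in>T. d i *\<^sub>R f i) = x1" unfolding T(3) by (simp add: d_def)
    also have "(\<Sum>i\<in>T'. d i *\<^sub>R f i) = (\<Sum>i\<in>T'. - (c' i *\<^sub>R f i))"
      using disj by (intro sum.cong) (auto simp: d_def)
    also have "\<dots> = - x2" unfolding T'(3) by (rule sum_negf)
    also have "x1 + - x2 = e2 - e1" using x(1,4) by (simp add: algebra_simps)
    finally have sum: "(\<Sum>i\<in>T \<union> T'. d i *\<^sub>R f i) = e2 - e1" .
    have "c i = 0" if "i \<in> T" for i
    proof -
      have "d i = 0"
      proof (rule zero)
        show "finite (T \<union> T')" using T(1) T'(1) by blast
        show "(\<Sum>i\<in>T \<union> T'. d i *\<^sub>R f i) \<in> span E" unfolding sum using x(5,2) by (rule span_diff)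
        show "i \<in> T \<union> T'" using that by blast
      qed
      then show ?thesis using that by (simp add: d_def)
    qed
    then have "x1 = 0" unfolding T(3) by (intro sum.neutral) simp
    then show "x \<in> span E" using x(1,2) by simp
  qed
  show "span E \<subseteq> span (E \<union> f ` A) \<inter> span (E \<union> f ` B)" using span_mono[of E] by blast
qed

text \<open>The cardinal of the reals is a well-order in which each index has fewer than continuum
  many predecessors. So \<open>E\<close> and the earlier choices are too few for their span to
  contain \<open>T i\<close>.\<close>

lemma transfinite_independent_choice:
  fixes T :: "real \<Rightarrow> ('v::real_vector) set" and r :: "real rel"
  defines "r \<equiv> |UNIV :: real set|"
  assumes E: "|E| <o |UNIV :: real set|"
    and T: "\<And>i Z. |Z| <o |UNIV :: real set| \<Longrightarrow> \<not> T i \<subseteq> span Z"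
  obtains f where "\<And>i. f i \<in> T i" "\<And>i. f i \<notin> span (E \<union> f ` underS r i)"
proof -
  have r: "well_order_on UNIV r" unfolding r_def by (rule card_of_well_order_on)
  have wf: "wf (r - Id)" using r unfolding well_order_on_def by blast
  have under: "underS r i = {z. (z, i) \<in> r - Id}" for i unfolding underS_def by blast
  have "\<exists>f. \<forall>i. f i \<in> T i \<and> f i \<notin> span (E \<union> f ` {z. (z, i) \<in> r - Id})"
  proof (rule dependent_wf_choice[OF wf])
    \<comment> \<open>Recursion with choice requires that the condition at \<open>i\<close> depend
      on the earlier values only.\<close>
    fix f g :: "real \<Rightarrow> 'v" and i v assume "\<And>z. (z, i) \<in> r - Id \<Longrightarrow> f z = g z"
    then have "f ` {z. (z, i) \<in> r - Id} = g ` {z. (z, i) \<in> r - Id}" by (intro image_cong) auto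
    then show "(v \<in> T i \<and> v \<notin> span (E \<union> f ` {z. (z, i) \<in> r - Id})) =
      (v \<in> T i \<and> v \<notin> span (E \<union> g ` {z. (z, i) \<in> r - Id}))" by simp
  next
    fix i and f :: "real \<Rightarrow> 'v"
    have "|underS r i| <o r"
      unfolding r_def by (rule card_of_underS[OF card_of_Card_order]) (simp add: Field_card_of)
    then have "|f ` underS r i| <o |UNIV :: real set|"
      unfolding r_def by (rule ordLeq_ordLess_trans[OF card_of_image])
    then have "|f ` {z. (z, i) \<in> r - Id}| <o |UNIV :: real set|" unfolding under .
    then have "|E \<union> f ` {z. (z, i) \<in> r - Id}| <o |UNIV :: real set|"
      by (rule card_of_Un_ordLess_infinite[OF infinite_UNIV_char_0 E])
    then show "\<exists>v. v \<in> T i \<and> v \<notin> span (E \<union> f ` {z. (z, i) \<in> r - Id})"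
      using T[of "E \<union> f ` {z. (z, i) \<in> r - Id}" i] by blast
  qed
  then obtain f where "\<forall>i. f i \<in> T i \<and> f i \<notin> span (E \<union> f ` underS r i)" unfolding under by (rule exE)
  then show thesis using that[of f] by blast
qed

section \<open>The two spaces\<close>

lemma card_of_Pow_mono:
  assumes "|A| \<le>o |B|"
  shows "|Pow A| \<le>o |Pow B|"
proof -
  obtain f where "inj_on f A" "f ` A \<subseteq> B" using assms card_of_ordLeq[of A B] by blast
  then show ?thesis by (intro card_of_ordLeqI[of "image f"]) (auto simp: inj_on_image_Pow)
qed

text \<open>A function is determined by the rationals below each of its values, hence by a subset of
  the product of \<open>X\<close> with the rationals; \<open>X\<close> absorbs the countable
  factor.\<close>

lemma card_of_supported_on_ordLeq:
  fixes X :: "'x set"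
  assumes "infinite X"
  shows "|supported_on X| \<le>o |Pow X|"
proof -
  define g :: "('x \<Rightarrow> real) \<Rightarrow> ('x \<times> rat) set" where "g y = {(i, q). i \<in> X \<and> of_rat q < y i}" for y
  have "inj_on g (supported_on X)"
  proof (rule inj_onI)
    fix y z assume yz: "y \<in> supported_on X" "z \<in> supported_on X" "g y = g z"
    show "y = z"
    proof
      fix i
      show "y i = z i"
      proof (cases "i \<in> X")
        case True
        then have *: "of_rat q < y i \<longleftrightarrow> of_rat q < z i" for q
          using yz(3) unfolding g_def by (auto simp: set_eq_iff)
        show ?thesis
        proof (rule ccontr)
          assume "y i \<noteq> z i"
          then consider "y i < z i" | "z i < y i" by linarith
          then show False using of_rat_dense * by cases (metis less_asym)+
        qed
      next
        case False
        then show ?thesis using yz by (simp add: supported_on_def)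
      qed
    qed
  qed
  moreover have "g ` supported_on X \<subseteq> Pow (X \<times> UNIV)" by (auto simp: g_def)
  ultimately have "|supported_on X| \<le>o |Pow (X \<times> (UNIV :: rat set))|"
    using card_of_ordLeq by blast
  moreover have "|UNIV :: rat set| \<le>o |X|"
  proof -
    have "|UNIV :: rat set| \<le>o |UNIV :: nat set|" using countable_card_of_nat[of "UNIV :: rat set"] by simp
    then show ?thesis using assms infinite_iff_card_of_nat ordLeq_transitive by blast
  qed
  then have "|X \<times> (UNIV :: rat set)| =o |X|"
    using assms by (intro conjunct1[OF card_of_Times_infinite]) auto
  then have "|Pow (X \<times> (UNIV :: rat set))| \<le>o |Pow X|"
    using card_of_Pow_mono ordIso_iff_ordLeq by blast
  ultimately show ?thesis by (rule ordLeq_transitive)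
qed

text \<open>Uncurried, a row-finite matrix is a function supported on \<open>I \<times> I\<close>,
  so both components of a pair are counted by \<open>card_of_supported_on_ordLeq\<close>.\<close>

lemma card_of_admissible_ordLeq:
  assumes I: "infinite I" "|Pow I| \<le>o |UNIV :: real set|"
  shows "|{(a, y). admissible I a y}| \<le>o |UNIV :: real set|"
proof -
  have "|supported_on (I \<times> I)| \<le>o |UNIV :: real set|"
  proof -
    have "infinite (I \<times> I)" using I(1) by (auto simp: finite_cartesian_product_iff)
    then have "|supported_on (I \<times> I)| \<le>o |Pow (I \<times> I)|" by (rule card_of_supported_on_ordLeq)
    moreover have "|I \<times> I| \<le>o |I|"
      using card_of_Times_same_infinite[OF I(1)] ordIso_imp_ordLeq by blast
    then have "|Pow (I \<times> I)| \<le>o |Pow I|" by (rule card_of_Pow_mono)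
    ultimately show ?thesis using I(2) by (rule ordLeq_transitive[OF ordLeq_transitive])
  qed
  moreover have "|supported_on I| \<le>o |UNIV :: real set|"
    using card_of_supported_on_ordLeq[OF I(1)] I(2) by (rule ordLeq_transitive)
  ultimately have "|supported_on (I \<times> I) \<times> supported_on I| \<le>o |UNIV :: real set|"
    by (intro card_of_Sigma_ordLeq_infinite[OF infinite_UNIV_char_0] ballI)
  moreover have "|{(a, y). admissible I a y}| \<le>o |supported_on (I \<times> I) \<times> supported_on I|"
  proof (rule card_of_ordLeqI[of "map_prod case_prod id"])
    have "inj (case_prod :: ('a \<Rightarrow> 'a \<Rightarrow> real) \<Rightarrow> _)" by (metis curry_case_prod injI)
    then show "inj_on (map_prod case_prod id) {(a :: 'a \<Rightarrow> 'a \<Rightarrow> real, y). admissible I a y}"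
      by (metis inj_on_id inj_on_subset map_prod_inj_on subset_UNIV UNIV_Times_UNIV)
    fix p :: "('a \<Rightarrow> 'a \<Rightarrow> real) \<times> ('a \<Rightarrow> real)" assume "p \<in> {(a, y). admissible I a y}"
    then obtain a y where p: "p = (a, y)" "row_finite_on I a" "y \<in> supported_on I"
      unfolding admissible_def by blast
    have "a i j = 0" if "(i, j) \<notin> I \<times> I" for i j
      using that p(2) by (cases "i \<in> I") (auto simp: row_finite_on_def finitely_supported_on_def supported_on_def)
    then show "map_prod case_prod id p \<in> supported_on (I \<times> I) \<times> supported_on I"
      using p by (auto simp: supported_on_def)
  qed
  ultimately show ?thesis by (rule ordLeq_transitive[rotated])
qed

section \<open>Construction of the two generic subspaces\<close>

lemma target_subset_supported_on:
  assumes "admissible I a y"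
  shows "target a y \<subseteq> supported_on I"
  using assms subspace_add[OF subspace_supported_on] mat_apply_supported_on
  unfolding target_def admissible_def by blast

lemma exists_generic_pair:
  fixes I :: "'i set"
  assumes I: "infinite I" "|Pow I| \<le>o |UNIV :: real set|"
  obtains K L where "generic_subspace I K" "generic_subspace I L" "K \<inter> L = finitely_supported_on I"
proof -
  \<comment> \<open>The boolean tag lists every admissible pair twice, and decides which of the two
    spaces receives the chosen point.\<close>
  define Q where "Q = (UNIV :: bool set) \<times> {(a, y :: 'i \<Rightarrow> real). admissible I a y}"
  define E where "E = (unit_fun ` I :: ('i \<Rightarrow> real) set)"
  \<comment> \<open>An admissible pair is exhibited because only a non-empty \<open>Q\<close> can be
    the image of the reals.\<close>
  define a0 where "a0 = (\<lambda>i. if i \<in> I then unit_fun i else (0 :: 'i \<Rightarrow> real))"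
  have "admissible I a0 0"
    unfolding admissible_def
  proof (intro conjI exI ballI)
    show "row_finite_on I a0"
      by (auto simp: row_finite_on_def a0_def finitely_supported_on_eq_span span_base)
    show "a0 j = 1 *\<^sub>R unit_fun j" if "j \<in> I" for j using that by (simp add: a0_def)
  qed (use I(1) in \<open>auto simp: supported_on_def\<close>)
  then have "Q \<noteq> {}" unfolding Q_def by blast
  moreover have "|Q| \<le>o |UNIV :: real set|"
    unfolding Q_def
  proof (intro card_of_Sigma_ordLeq_infinite[OF infinite_UNIV_char_0] ballI card_of_admissible_ordLeq I)
    show "|UNIV :: bool set| \<le>o |UNIV :: real set|"
      by (intro ordLess_imp_ordLeq finite_ordLess_infinite)
        (simp_all add: card_of_well_order_on Field_card_of infinite_UNIV_char_0)
  qed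
  ultimately obtain g :: "real \<Rightarrow> bool \<times> ('i \<Rightarrow> 'i \<Rightarrow> real) \<times> ('i \<Rightarrow> real)" where g: "g ` UNIV = Q"
    using card_of_ordLeq2[of Q "UNIV :: real set"] by blast
  define T where "T i = target (fst (snd (g i))) (snd (snd (g i)))" for i
  have adm: "admissible I (fst (snd (g i))) (snd (snd (g i)))" for i
  proof -
    have "g i \<in> Q" using g by blast
    then show ?thesis unfolding Q_def by auto
  qed
  \<comment> \<open>By Cantor, \<open>I\<close> is smaller than \<open>Pow I\<close>, hence smaller
    than the continuum.\<close>
  have E: "|E| <o |UNIV :: real set|"
    unfolding E_def
    by (rule ordLeq_ordLess_trans[OF card_of_image ordLess_ordLeq_trans[OF card_of_Pow I(2)]])
  have nT: "\<not> T i \<subseteq> span Z" if "|Z| <o |UNIV :: real set|" for i and Z :: "('i \<Rightarrow> real) set"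
    unfolding T_def by (rule admissible_target_not_subset_span[OF adm that])
  obtain f where f: "\<And>i. f i \<in> T i" "\<And>i. f i \<notin> span (E \<union> f ` underS |UNIV :: real set| i)"
    using transfinite_independent_choice[of E T, OF E nT] by blast
  have fI: "f i \<in> supported_on I" for i
    using f(1)[of i] target_subset_supported_on[OF adm[of i]] unfolding T_def by blast
  define V where "V b = span (E \<union> f ` {i. fst (g i) = b})" for b
  have generic: "generic_subspace I (V b)" for b
    unfolding generic_subspace_def
  proof (intro conjI allI impI)
    show "subspace (V b)" unfolding V_def by (rule subspace_span)
    have "E \<subseteq> supported_on I" unfolding E_def by (auto simp: supported_on_def unit_fun_def)
    then show "V b \<subseteq> supported_on I"
      unfolding V_def using fI by (intro span_minimal subspace_supported_on) blast
    fix a y assume "admissible I a y"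
    then have "(b, a, y) \<in> Q" unfolding Q_def by blast
    then obtain i where i: "g i = (b, a, y)" using g by (metis rangeE)
    then have "f i \<in> V b" unfolding V_def by (intro span_base) auto
    moreover have "f i \<in> target a y" using f(1)[of i] i unfolding T_def by simp
    ultimately show "V b \<inter> target a y \<noteq> {}" by blast
  qed
  have lin: "linear_order_on UNIV |UNIV :: real set|"
    using card_of_well_order_on[of "UNIV :: real set"] unfolding well_order_on_def by blast
  have "V True \<inter> V False = span E"
    unfolding V_def by (rule span_Int_of_transfinite_independent[OF lin f(2)]) auto
  then have "V True \<inter> V False = finitely_supported_on I"
    unfolding E_def finitely_supported_on_eq_span .
  then show thesis using generic that by blast
qed

text \<open>Here \<open>cardSuc natLeq\<close> is \<omega>_1, and the hypothesis is the equality of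
  its power with the continuum; the set \<open>I\<close> is a copy of \<omega>_1 among the
  reals.\<close>

lemma exists_uncountable_small_power:
  assumes "ctwo ^c cardSuc natLeq =o ctwo ^c natLeq"
  obtains I :: "real set" where "uncountable I" "|Pow I| \<le>o |UNIV :: real set|"
proof -
  obtain h :: "nat set \<Rightarrow> real" where h: "bij h"
    using nat_sets_eqpoll_reals unfolding eqpoll_def by blast
  \<comment> \<open>By its type, \<open>cardSuc natLeq\<close> is a relation on sets of naturals, so
    \<open>h\<close> carries its field into the reals.\<close>
  define W where "W = Field (cardSuc natLeq)"
  have W: "|W| =o cardSuc natLeq"
    unfolding W_def by (rule card_of_Field_ordIso[OF cardSuc_Card_order[OF natLeq_Card_order]])
  have hW: "|W| =o |h ` W|"
    by (intro card_of_ordIsoI[of h])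
      (simp add: bij_betw_def inj_on_subset[OF bij_is_inj[OF h] subset_UNIV])
  have "uncountable (h ` W)"
  proof
    assume "countable (h ` W)"
    then have "|h ` W| \<le>o natLeq" by (simp add: countable_card_le_natLeq)
    then have "cardSuc natLeq \<le>o natLeq"
      using W hW by (metis ordIso_ordLeq_trans ordIso_symmetric)
    then show False using cardSuc_greater[OF natLeq_Card_order] not_ordLess_ordLeq by blast
  qed
  moreover have "|Pow (h ` W)| \<le>o |UNIV :: real set|"
  proof -
    have "|h ` W| \<le>o |W|" by (rule card_of_image)
    then have "|Pow (h ` W)| \<le>o |Pow W|" by (rule card_of_Pow_mono)
    also have "|Pow W| =o |Func W (UNIV :: bool set)|" by (rule card_of_Pow_Func)
    also have "|Func W (UNIV :: bool set)| =o |Func (UNIV :: nat set) (UNIV :: bool set)|"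
      using assms unfolding cexp_def ctwo_def W_def Field_card_of Field_natLeq .
    also have "|Func (UNIV :: nat set) (UNIV :: bool set)| =o |UNIV :: nat set set|"
      using card_of_Pow_Func[of "UNIV :: nat set"] ordIso_symmetric by (metis Pow_UNIV)
    also have "|UNIV :: nat set set| =o |UNIV :: real set|" using h by (rule card_of_ordIsoI)
    finally show ?thesis .
  qed
  ultimately show thesis by (rule that)
qed

section \<open>The finitely supported functions and their diagonal\<close>

lemma sigma_compact_finitely_supported_on:
  obtains C :: "nat \<Rightarrow> ('i \<Rightarrow> real) set"
  where "\<And>n. compact (C n)" "(\<Union>n. C n) = finitely_supported_on I"
proof -
  \<comment> \<open>Functions bounded by \<open>n\<close> with at most \<open>n\<close> nonzero
    values. Asking for a zero among any \<open>n + 1\<close> coordinates makes the bound on the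
    support a closed condition.\<close>
  define C where "C n = (\<Inter>i. {x. \<bar>x i\<bar> \<le> real n}) \<inter> supported_on I \<inter>
    (\<Inter>A\<in>{A. finite A \<and> card A = Suc n}. \<Union>i\<in>A. {x. x i = 0})" for n :: nat
  have "compact (C n)" for n
  proof -
    have "compactin (product_topology (\<lambda>_. euclideanreal) UNIV) (PiE UNIV (\<lambda>_ :: 'i. {- real n .. real n}))"
      by (simp add: compactin_PiE)
    then have 1: "compact (PiE UNIV (\<lambda>_ :: 'i. {- real n .. real n}))"
      unfolding euclidean_product_topology by simp
    have cl0: "closed {x :: 'i \<Rightarrow> real. x i = 0}" for i
      by (intro closed_Collect_eq continuous_on_product_coordinates continuous_on_const)
    have "closed (supported_on I \<inter> (\<Inter>A\<in>{A. finite A \<and> card A = Suc n}. \<Union>i\<in>A. {x :: 'i \<Rightarrow> real. x i = 0}))"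
      by (intro closed_Int closed_supported_on closed_INT ballI closed_UN cl0) auto
    from compact_Int_closed[OF 1 this] show ?thesis
      by (rule back_subst[of compact]) (auto simp: C_def PiE_iff abs_le_iff minus_le_iff)
  qed
  moreover have "(\<Union>n. C n) = finitely_supported_on I"
  proof (intro equalityI subsetI)
    fix x assume "x \<in> (\<Union>n. C n)"
    then obtain n where x: "x \<in> C n" by blast
    have "finite {i. x i \<noteq> 0}"
    proof (rule ccontr)
      assume "infinite {i. x i \<noteq> 0}"
      then obtain A where "finite A" "card A = Suc n" "A \<subseteq> {i. x i \<noteq> 0}"
        using infinite_arbitrarily_large by blast
      then show False using x unfolding C_def by blast
    qed
    then show "x \<in> finitely_supported_on I" using x unfolding C_def finitely_supported_on_def by blast
  next
    fix x assume x: "x \<in> finitely_supported_on I"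
    let ?S = "{i. x i \<noteq> 0}"
    have fin: "finite ?S" using x by (simp add: finitely_supported_on_def)
    obtain m where m: "(\<Sum>i\<in>?S. \<bar>x i\<bar>) \<le> real m" using real_arch_simple by blast
    define n where "n = max m (card ?S)"
    have "\<bar>x i\<bar> \<le> real n" for i
    proof (cases "x i = 0")
      case False
      then have "\<bar>x i\<bar> \<le> (\<Sum>i\<in>?S. \<bar>x i\<bar>)" using fin by (intro member_le_sum) auto
      then show ?thesis using m unfolding n_def by linarith
    qed simp
    moreover have "\<exists>i\<in>A. x i = 0" if A: "finite A" "card A = Suc n" for A
    proof (rule ccontr)
      assume "\<not> (\<exists>i\<in>A. x i = 0)"
      then have "card A \<le> card ?S" using fin by (intro card_mono) auto
      then show False using A(2) unfolding n_def by simp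
    qed
    ultimately have "x \<in> C n" using x unfolding C_def finitely_supported_on_def by blast
    then show "x \<in> (\<Union>n. C n)" by blast
  qed
  ultimately show thesis by (rule that)
qed

theorem theorem4p5:
  assumes "ctwo ^c cardSuc natLeq =o ctwo ^c natLeq"
  shows "\<exists>(K :: (real \<Rightarrow> real) topology) (L :: (real \<Rightarrow> real) topology).
    locally_convex_space K \<and> pseudocomplete K \<and>
    locally_convex_space L \<and> pseudocomplete L \<and>
    (\<forall>S. closed_vector_subspace K S \<longrightarrow> separable_space (subtopology K S)) \<and>
    (\<forall>S. closed_vector_subspace L S \<longrightarrow> separable_space (subtopology L S)) \<and>
    (\<exists>M. closed_vector_subspace (prod_topology K L) M \<and>
         sigma_compact_space (subtopology (prod_topology K L) M) \<and>
         \<not> separable_space (subtopology (prod_topology K L) M))"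
proof -
  obtain I :: "real set" where I: "uncountable I" "|Pow I| \<le>o |UNIV :: real set|"
    by (rule exists_uncountable_small_power[OF assms])
  have infI: "infinite I" using I(1) by (rule uncountable_infinite)
  obtain K L where K: "generic_subspace I K" and L: "generic_subspace I L"
    and KL: "K \<inter> L = finitely_supported_on I"
    by (rule exists_generic_pair[OF infI I(2)])
  have sub: "subspace K" "subspace L" using K L unfolding generic_subspace_def by blast+
  let ?K = "subtopology euclidean K" and ?L = "subtopology euclidean L"
  define diag where "diag = (\<lambda>x :: real \<Rightarrow> real. (x, x))"
  define M where "M = diag ` finitely_supported_on I"
  let ?P = "prod_topology ?K ?L"
  \<comment> \<open>A pair in \<open>K \<times> L\<close> with equal components lies over
    \<open>K \<inter> L\<close>, so \<open>M\<close> is where the two projections agree, which is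
    closed in the Hausdorff case.\<close>
  have M_eq: "M = {p \<in> topspace ?P. fst p = snd p}"
    unfolding M_def diag_def KL[symmetric] by auto
  have fst_map: "continuous_map ?P euclidean fst" and snd_map: "continuous_map ?P euclidean snd"
    using continuous_map_fst[of ?K ?L] continuous_map_snd[of ?K ?L]
    unfolding continuous_map_in_subtopology by blast+
  have "closedin ?P M"
    unfolding M_eq by (rule closedin_continuous_maps_eq[OF Hausdorff_space_euclidean_fun fst_map snd_map])
  moreover have "linear diag" by (rule linearI) (simp_all add: diag_def)
  then have "subspace M"
    unfolding M_def by (rule linear_subspace_image[OF _ subspace_finitely_supported_on])
  ultimately have 1: "closed_vector_subspace ?P M" unfolding closed_vector_subspace_def by blast
  obtain C :: "nat \<Rightarrow> (real \<Rightarrow> real) set"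
    where C: "\<And>n. compact (C n)" "(\<Union>n. C n) = finitely_supported_on I"
    using sigma_compact_finitely_supported_on by blast
  have diag_map: "continuous_map (subtopology euclidean (finitely_supported_on I)) ?P diag"
    unfolding diag_def using KL
    by (intro continuous_map_pairedI) (auto simp: continuous_map_in_subtopology)
  have MP: "M \<subseteq> topspace ?P" using M_eq by blast
  have 2: "sigma_compact_space (subtopology ?P M)"
    unfolding sigma_compact_space_def
  proof (intro exI[of _ "range (\<lambda>n. diag ` C n)"] conjI ballI)
    show "countable (range (\<lambda>n. diag ` C n))" by simp
    fix D assume "D \<in> range (\<lambda>n. diag ` C n)"
    then obtain n where D: "D = diag ` C n" by blast
    have "C n \<subseteq> finitely_supported_on I" using C(2) by blast
    then have "compactin (subtopology euclidean (finitely_supported_on I)) (C n)"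
      using C(1)[of n] by (simp add: compactin_subtopology)
    then have "compactin ?P D" unfolding D by (rule image_compactin[OF _ diag_map])
    moreover have "D \<subseteq> M" unfolding D M_def using C(2) by blast
    ultimately show "compactin (subtopology ?P M) D" by (simp add: compactin_subtopology)
  next
    have "topspace (subtopology ?P M) = M" using MP by (rule topspace_subtopology_subset)
    also have "\<dots> = \<Union>(range (\<lambda>n. diag ` C n))" unfolding M_def C(2)[symmetric] by blast
    finally show "topspace (subtopology ?P M) = \<Union>(range (\<lambda>n. diag ` C n))" .
  qed
  have 3: "\<not> separable_space (subtopology ?P M)"
  proof
    assume "separable_space (subtopology ?P M)"
    then obtain X where X: "countable X" "X \<subseteq> M" "subtopology ?P M closure_of X = M"
      unfolding separable_space_def topspace_subtopology_subset[OF MP] by blast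
    \<comment> \<open>A countable set of finitely supported points uses only countably many
      coordinates; any other \<open>i \<in> I\<close> gives an open set, positivity at
      \<open>i\<close>, that misses \<open>X\<close> but contains the diagonal point of
      \<open>unit_fun i\<close>.\<close>
    define S where "S = (\<Union>p\<in>X. {i. fst p i \<noteq> 0})"
    have "countable S"
      unfolding S_def using X(1)
    proof (rule countable_UN)
      fix p assume "p \<in> X"
      then have "fst p \<in> finitely_supported_on I" using X(2) unfolding M_def diag_def by auto
      then show "countable {i. fst p i \<noteq> 0}"
        by (intro countable_finite) (simp add: finitely_supported_on_def)
    qed
    then obtain i where i: "i \<in> I" "i \<notin> S" using I(1) by (meson countable_subset subsetI)
    let ?U = "{p \<in> topspace ?P. fst p i \<in> {0<..}}"
    have "continuous_map ?P euclideanreal (\<lambda>p. fst p i)"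
      using fst_map unfolding continuous_map_into_euclidean_fun by blast
    then have "openin ?P ?U" by (rule openin_continuous_map_preimage) simp
    then have U: "openin (subtopology ?P M) (?U \<inter> M)" by (rule openin_subtopology_Int)
    have "unit_fun i \<in> finitely_supported_on I"
      using i(1) by (simp add: finitely_supported_on_eq_span span_base)
    then have e: "diag (unit_fun i) \<in> M" unfolding M_def by blast
    then have "diag (unit_fun i) \<in> topspace ?P" using MP by blast
    moreover have "fst (diag (unit_fun i)) i \<in> {0<..}" by (simp add: diag_def)
    ultimately have "diag (unit_fun i) \<in> ?U \<inter> M" using e by blast
    moreover have "diag (unit_fun i) \<in> subtopology ?P M closure_of X" using e X(3) by simp
    ultimately obtain p where p: "p \<in> X" "p \<in> ?U \<inter> M" using U unfolding in_closure_of by meson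
    then have "0 < fst p i" by simp
    then have "fst p i \<noteq> 0" by simp
    then show False using p(1) i(2) unfolding S_def by blast
  qed
  show ?thesis
  proof (intro exI conjI allI impI)
    show "closed_vector_subspace ?P M" "sigma_compact_space (subtopology ?P M)"
      "\<not> separable_space (subtopology ?P M)" by fact+
    show "pseudocomplete ?K" "pseudocomplete ?L"
      by (rule generic_subspace_pseudocomplete[OF K I(1)], rule generic_subspace_pseudocomplete[OF L I(1)])
    show "locally_convex_space ?K" "locally_convex_space ?L"
      by (rule locally_convex_space_subtopology_fun[OF sub(1)], rule locally_convex_space_subtopology_fun[OF sub(2)])
    show "separable_space (subtopology ?K S)" if "closed_vector_subspace ?K S" for S
      using K that by (rule generic_subspace_separable)
    show "separable_space (subtopology ?L S)" if "closed_vector_subspace ?L S" for S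
      using L that by (rule generic_subspace_separable)
  qed
qed

end
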